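(* Let $m,N\geq0$, $g\in\Lambda_m$ and $f\in\mathrm{QSym}_N$ (so that $gf\in\mathrm{QSym}_{N+m}$, since $\Lambda_m\subseteq\mathrm{QSym}_m$). Then $$\Phi_{N+m}(gf)=\rho(g)\,\Phi_N(f).$$ In particular, for every partition $\lambda$, $\Phi_{N+|\lambda|}(s_\lambda f)=\mathcal G_\lambda\,\Phi_N(f)$. Moreover, for all partitions $\lambda$ and $\mu$, $$\mathcal G_\lambda\mathcal G_\mu=\sum_{\nu\vdash|\lambda|+|\mu|}c_{\lambda\mu}^{\nu}\,\mathcal G_\nu .$$
   Context: Work over $\mathbb Q$. $\mathrm{QSym}_N$ is the degree-$N$ homogeneous component of the ring of quasisymmetric functions in commuting variables $z_1,z_2,\ldots$. For $N\geq1$ and $S\subseteq[N-1]$, $F_{N,S}=\sum z_{i_1}\cdots z_{i_N}$ over $1\leq i_1\leq\cdots\leq i_N$ with $i_j<i_{j+1}$ for all $j\in S$; $F_{0,\varnothing}=1$. These form a basis of $\mathrm{QSym}_N$. The linear map $\Phi_N:\mathrm{QSym}_N\to\mathbb Q[x,y]$ is defined by $\Phi_N(F_{N,S})=x^{|S|+1}y^{N-|S|}$, with $\Phi_0(1)=x$. With $D=\partial_x+\partial_y$, put $\mathcal G_0=\mathrm{id}$, $\mathcal G_r=y^r\sum_{j=1}^{r}\binom{r-1}{j-1}\frac{x^j}{j!}D^j$ for $r\geq1$ (operators on $\mathbb Q[x,y]$), and $\mathcal G_m=0$ for $m<0$. The operators $\mathcal G_r$ commute pairwise. $\Lambda=\mathbb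 Q[h_1,h_2,\ldots]$ is the ring of symmetric functions over $\mathbb Q$, freely generated by the complete homogeneous functions $h_r$, and $\Lambda_m$ is its degree-$m$ component. $\rho:\Lambda\to\mathrm{End}_{\mathbb Q}(\mathbb Q[x,y])$ is the unique unital algebra homomorphism with $\rho(h_r)=\mathcal G_r$ (the product in the endomorphism algebra is composition). For a partition $\lambda=(\lambda_1,\ldots,\lambda_\ell)$ of size $|\lambda|$, $s_\lambda$ is the Schur function and $\mathcal G_\lambda=\rho(s_\lambda)=\det(\mathcal G_{\lambda_i-i+j})_{1\leq i,j\leq\ell}$. The Littlewood–Richardson coefficients $c_{\lambda\mu}^\nu$ are defined by $s_\lambda s_\mu=\sum_\nu c_{\lambda\mu}^\nu s_\nu$. *)

theory Defs
  imports
    "HOL-Library.Multiset"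
    "HOL-Library.FuncSet"
    "HOL-Computational_Algebra.Polynomial"
begin

section \<open>Power series in countably many commuting variables\<close>

text \<open>
  The variables are indexed by \<open>nat\<close>, index \<open>i\<close> standing for \<open>z\<^sub>i\<^sub>+\<^sub>1\<close>; only the order of the
  indices matters. A monomial is the multiset of the indices of its factors, and a series is
  the family of its coefficients.
\<close>

typedef mseries = "UNIV :: (nat multiset \<Rightarrow> rat) set"
  morphisms mcoeff Mseries ..

setup_lifting type_definition_mseries

lemma mseries_eqI: "(\<And>M. mcoeff f M = mcoeff g M) \<Longrightarrow> f = g"
  by (simp add: mcoeff_inject[symmetric] ext)

definition mset_splits :: "'a multiset \<Rightarrow> ('a multiset \<times> 'a multiset) set" where
  "mset_splits M = {(A, B). A + B = M}"

lemma finite_mset_splits [simp]: "finite (mset_splits M)"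
proof -
  have "finite {A. A \<subseteq># M}"
  proof (induction M)
    case (add x M)
    have "{A. A \<subseteq># add_mset x M} \<subseteq> {A. A \<subseteq># M} \<union> add_mset x ` {A. A \<subseteq># M}"
    proof
      fix A assume "A \<in> {A. A \<subseteq># add_mset x M}"
      then have A: "A \<subseteq># add_mset x M" by simp
      show "A \<in> {A. A \<subseteq># M} \<union> add_mset x ` {A. A \<subseteq># M}"
      proof (cases "x \<in># A")
        case True
        then obtain A' where "A = add_mset x A'" by (metis multi_member_split)
        with A show ?thesis by auto
      next
        case False
        with A have "A \<subseteq># M"
          by (metis add_mset_remove_trivial diff_single_trivial subset_eq_diff_conv add_mset_add_single)
        then show ?thesis by simp
      qed
    qed
    with add show ?case by (meson finite_UnI finite_imageI finite_subset)
  qed simp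
  then have "finite ((\<lambda>A. (A, M - A)) ` {A. A \<subseteq># M})" by simp
  moreover have "mset_splits M \<subseteq> (\<lambda>A. (A, M - A)) ` {A. A \<subseteq># M}"
    by (auto simp: mset_splits_def)
  ultimately show ?thesis by (rule finite_subset[rotated])
qed

instantiation mseries :: comm_ring_1
begin

lift_definition zero_mseries :: mseries is "\<lambda>M. 0" .
lift_definition one_mseries :: mseries is "\<lambda>M. if M = {#} then 1 else 0" .
lift_definition plus_mseries :: "mseries \<Rightarrow> mseries \<Rightarrow> mseries" is "\<lambda>f g M. f M + g M" .
lift_definition minus_mseries :: "mseries \<Rightarrow> mseries \<Rightarrow> mseries" is "\<lambda>f g M. f M - g M" .
lift_definition uminus_mseries :: "mseries \<Rightarrow> mseries" is "\<lambda>f M. - f M" .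
lift_definition times_mseries :: "mseries \<Rightarrow> mseries \<Rightarrow> mseries" is
  "\<lambda>f g M. \<Sum>(A, B)\<in>mset_splits M. f A * g B" .

instance
proof
  fix a b c :: mseries
  show "a + b + c = a + (b + c)" "a + b = b + a" "0 + a = a" "- a + a = 0" "a - b = a + - b"
    by (transfer, simp add: fun_eq_iff)+
  show "(0::mseries) \<noteq> 1"
    by transfer (auto simp: fun_eq_iff intro!: exI[of _ "{#} :: nat multiset"])
  show "(a + b) * c = a * c + b * c"
    by transfer (simp add: fun_eq_iff algebra_simps sum.distrib case_prod_unfold)
  show "a * b = b * a"
  proof (transfer, rule ext)
    fix f g :: "nat multiset \<Rightarrow> rat" and M
    show "(\<Sum>(A, B)\<in>mset_splits M. f A * g B) = (\<Sum>(A, B)\<in>mset_splits M. g A * f B)"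
      by (rule sum.reindex_bij_witness[of _ prod.swap prod.swap])
        (auto simp: mset_splits_def add.commute)
  qed
  show "1 * a = a"
  proof (transfer, rule ext)
    fix f :: "nat multiset \<Rightarrow> rat" and M
    have "(\<Sum>(A, B)\<in>mset_splits M. (if A = {#} then 1 else 0) * f B)
      = (\<Sum>(A, B)\<in>{({#} :: nat multiset, M)}. (if A = {#} then 1 else 0) * f B)"
      by (rule sum.mono_neutral_right[OF finite_mset_splits])
        (auto simp: mset_splits_def split: if_splits)
    then show "(\<Sum>(A, B)\<in>mset_splits M. (if A = {#} then 1 else 0) * f B) = f M" by simp
  qed
  show "a * b * c = a * (b * c)"
  proof (transfer, rule ext)
    fix f g h :: "nat multiset \<Rightarrow> rat" and M
    have "(\<Sum>(A, B)\<in>mset_splits M. (\<Sum>(C, D)\<in>mset_splits A. f C * g D) * h B)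
      = (\<Sum>(P, Q)\<in>(SIGMA P:mset_splits M. mset_splits (fst P)).
            f (fst Q) * g (snd Q) * h (snd P))"
      by (subst sum.Sigma[symmetric]) (auto simp: case_prod_unfold sum_distrib_right)
    also have "\<dots> = (\<Sum>(P, Q)\<in>(SIGMA P:mset_splits M. mset_splits (snd P)).
            f (fst P) * (g (fst Q) * h (snd Q)))"
      by (rule sum.reindex_bij_witness[of _
            "\<lambda>(P, Q). ((fst P + fst Q, snd Q), (fst P, fst Q))"
            "\<lambda>(P, Q). ((fst Q, snd Q + snd P), (snd Q, snd P))"])
        (auto simp: mset_splits_def algebra_simps)
    also have "\<dots> = (\<Sum>(A, B)\<in>mset_splits M. f A * (\<Sum>(C, D)\<in>mset_splits B. g C * h D))"
      by (subst sum.Sigma[symmetric]) (auto simp: case_prod_unfold sum_distrib_left)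
    finally show "(\<Sum>(A, B)\<in>mset_splits M. (\<Sum>(C, D)\<in>mset_splits A. f C * g D) * h B)
      = (\<Sum>(A, B)\<in>mset_splits M. f A * (\<Sum>(C, D)\<in>mset_splits B. g C * h D))" .
  qed
qed

end

lift_definition mscale :: "rat \<Rightarrow> mseries \<Rightarrow> mseries" is "\<lambda>c f M. c * f M" .

definition homogeneous :: "nat \<Rightarrow> mseries \<Rightarrow> bool" where
  "homogeneous N f \<longleftrightarrow> (\<forall>M. mcoeff f M \<noteq> 0 \<longrightarrow> size M = N)"


section \<open>Quasisymmetric functions\<close>

text \<open>
  Pushing a monomial forward along an index map that is strictly increasing on its support
  turns \<open>z\<^bsub>i1\<^esub>\<^bsup>a1\<^esup> \<dots> z\<^bsub>ik\<^esub>\<^bsup>ak\<^esup>\<close> with \<open>i1 < \<dots> < ik\<close> into an arbitrary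
  \<open>z\<^bsub>j1\<^esub>\<^bsup>a1\<^esup> \<dots> z\<^bsub>jk\<^esub>\<^bsup>ak\<^esup>\<close> with \<open>j1 < \<dots> < jk\<close>.
\<close>

definition quasisymmetric :: "mseries \<Rightarrow> bool" where
  "quasisymmetric f \<longleftrightarrow> (\<forall>M \<phi>. strict_mono_on (set_mset M) \<phi> \<longrightarrow>
      mcoeff f (image_mset \<phi> M) = mcoeff f M)"

definition QSym :: "nat \<Rightarrow> mseries set" where
  "QSym N = {f. quasisymmetric f \<and> homogeneous N f}"

text \<open>
  The coefficient of a monomial counts the index sequences \<open>i\<^sub>1 \<le> \<dots> \<le> i\<^sub>N\<close> producing it. Lists are
  indexed from 0, so that \<open>i\<^sub>j\<close> is \<open>is ! (j - 1)\<close>.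
\<close>

lift_definition fundamental :: "nat \<Rightarrow> nat set \<Rightarrow> mseries" is
  "\<lambda>N S M. of_nat (card {is :: nat list. length is = N \<and> sorted is \<and>
      (\<forall>j\<in>S. is ! (j - 1) < is ! j) \<and> mset is = M})" .

definition fundamental_coeffs :: "nat \<Rightarrow> mseries \<Rightarrow> nat set \<Rightarrow> rat" where
  "fundamental_coeffs N f = (THE c. (\<forall>S. \<not> S \<subseteq> {1..<N} \<longrightarrow> c S = 0) \<and>
      f = (\<Sum>S\<in>Pow {1..<N}. mscale (c S) (fundamental N S)))"


section \<open>The polynomial ring in \<open>x\<close>, \<open>y\<close> and its operators\<close>

text \<open>
  \<open>\<rat>[x, y]\<close> is represented as \<open>\<rat>[y][x]\<close>: the outer variable is \<open>x\<close>, the coefficients are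
  polynomials in \<open>y\<close>.
\<close>

type_synonym poly_xy = "rat poly poly"

definition X :: poly_xy where "X = [:0, 1:]"
definition Y :: poly_xy where "Y = [:[:0, 1:]:]"

definition scale_xy :: "rat \<Rightarrow> poly_xy \<Rightarrow> poly_xy" where
  "scale_xy c p = smult [:c:] p"

definition D :: "poly_xy \<Rightarrow> poly_xy" where
  "D p = pderiv p + map_poly pderiv p"

text \<open>For \<open>N = 0\<close> the formula below gives \<open>\<Phi>\<^sub>0(1) = x\<close>.\<close>

definition Phi :: "nat \<Rightarrow> mseries \<Rightarrow> poly_xy" where
  "Phi N f = (\<Sum>S\<in>Pow {1..<N}.
      scale_xy (fundamental_coeffs N f S) (X ^ (card S + 1) * Y ^ (N - card S)))"

definition G :: "nat \<Rightarrow> poly_xy \<Rightarrow> poly_xy" where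
  "G r = (if r = 0 then id else (\<lambda>p. Y ^ r * (\<Sum>j = 1..r.
      scale_xy (of_nat ((r - 1) choose (j - 1)) / fact j) (X ^ j * (D ^^ j) p))))"


section \<open>Symmetric functions\<close>

definition Sym :: "mseries set" where
  "Sym = {f. (\<forall>\<pi> M. bij \<pi> \<longrightarrow> mcoeff f (image_mset \<pi> M) = mcoeff f M) \<and>
      (\<exists>d. \<forall>M. mcoeff f M \<noteq> 0 \<longrightarrow> size M \<le> d)}"

definition Sym_deg :: "nat \<Rightarrow> mseries set" where
  "Sym_deg m = {f \<in> Sym. homogeneous m f}"

lift_definition complete_h :: "nat \<Rightarrow> mseries" is "\<lambda>r M. if size M = r then 1 else 0" .

text \<open>
  Unital algebra homomorphisms from \<open>Sym\<close> to the linear endomorphisms of \<open>\<rat>[x, y]\<close> sending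
  \<open>h\<^sub>r\<close> to \<open>G r\<close>. The value outside \<open>Sym\<close> is fixed only to make the function unique.
\<close>

definition is_rho :: "(mseries \<Rightarrow> poly_xy \<Rightarrow> poly_xy) \<Rightarrow> bool" where
  "is_rho R \<longleftrightarrow>
      R \<in> extensional Sym \<and>
      (\<forall>f\<in>Sym. Vector_Spaces.linear scale_xy scale_xy (R f)) \<and>
      R 1 = id \<and>
      (\<forall>f\<in>Sym. \<forall>g\<in>Sym. R (f + g) = (\<lambda>p. R f p + R g p)) \<and>
      (\<forall>c. \<forall>f\<in>Sym. R (mscale c f) = (\<lambda>p. scale_xy c (R f p))) \<and>
      (\<forall>f\<in>Sym. \<forall>g\<in>Sym. R (f * g) = R f \<circ> R g) \<and>
      (\<forall>r\<ge>1. R (complete_h r) = G r)"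

definition rho :: "mseries \<Rightarrow> poly_xy \<Rightarrow> poly_xy" where
  "rho = (THE R. is_rho R)"


section \<open>Schur functions and Littlewood--Richardson coefficients\<close>

definition is_partition :: "nat list \<Rightarrow> bool" where
  "is_partition la \<longleftrightarrow> sorted_wrt (\<ge>) la \<and> 0 \<notin> set la"

definition partitions_of :: "nat \<Rightarrow> nat list set" where
  "partitions_of n = {la. is_partition la \<and> sum_list la = n}"

definition cells :: "nat list \<Rightarrow> (nat \<times> nat) set" where
  "cells la = {(i, j). i < length la \<and> j < la ! i}"

text \<open>Semistandard Young tableaux: rows weakly and columns strictly increasing.\<close>

definition ssyt :: "nat list \<Rightarrow> (nat \<times> nat \<Rightarrow> nat) set" where
  "ssyt la = {T \<in> extensional (cells la).
      (\<forall>i j j'. (i, j) \<in> cells la \<and> (i, j') \<in> cells la \<and> j < j' \<longrightarrow> T (i, j) \<le> T (i, j')) \<and>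
      (\<forall>i i' j. (i, j) \<in> cells la \<and> (i', j) \<in> cells la \<and> i < i' \<longrightarrow> T (i, j) < T (i', j))}"

lift_definition schur :: "nat list \<Rightarrow> mseries" is
  "\<lambda>la M. of_nat (card {T \<in> ssyt la. image_mset T (mset_set (cells la)) = M})" .

definition lr_coeff :: "nat list \<Rightarrow> nat list \<Rightarrow> nat list \<Rightarrow> rat" where
  "lr_coeff la mu = (THE c.
      (\<forall>nu. nu \<notin> partitions_of (sum_list la + sum_list mu) \<longrightarrow> c nu = 0) \<and>
      schur la * schur mu =
        (\<Sum>nu\<in>partitions_of (sum_list la + sum_list mu). mscale (c nu) (schur nu)))"

definition G_part :: "nat list \<Rightarrow> poly_xy \<Rightarrow> poly_xy" where
  "G_part la = rho (schur la)"

end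

theory Submission
  imports
    Defs
    "HOL-Computational_Algebra.Formal_Power_Series"
    "HOL-Combinatorics.Permutations"
begin

text \<open>
  In the coordinates \<open>u = x / y\<close> and \<open>d = y - x\<close> all operators \<open>G\<^sub>r\<close> are simultaneously diagonal:
  \<open>x y D\<close> becomes \<open>d u \<partial>\<^sub>u\<close>, and the recurrence
  \<open>(r + 1) G\<^sub>r\<^sub>+\<^sub>1 = (x y D + r (y - x)) G\<^sub>r\<close> shows that \<open>G\<^sub>r\<close> multiplies \<open>u\<^sup>k\<close> by
  \<open>h\<^sub>r(d, \<dots>, d)\<close> (\<open>k\<close> arguments). Since the \<open>h\<^sub>r\<close> generate the ring of symmetric functions, \<open>\<rho>(g)\<close>
  exists, is unique, and multiplies \<open>u\<^sup>k\<close> by \<open>g(d, \<dots>, d)\<close>; no algebraic independence is needed.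
  On the other side, expanding \<open>\<Phi>\<^sub>N(f)\<close> in powers of \<open>u\<close> gives
  \<open>\<Sum>\<^sub>k\<^sub>\<ge>\<^sub>1 d f(d, \<dots>, d) u\<^sup>k\<close>, because \<open>\<Sum>\<^sub>k F\<^sub>N\<^sub>,\<^sub>S(1, \<dots>, 1) u\<^sup>k = u\<^bsup>|S|+1\<^esup> / (1 - u)\<^bsup>N+1\<^esup>\<close>. Hence
  \<open>\<Phi>(g f) = \<rho>(g) \<Phi>(f)\<close> is the multiplicativity of specialisation.
  The product rule for the \<open>G\<^sub>\<lambda>\<close> is the image under \<open>\<rho>\<close> of the expansion of \<open>s\<^sub>\<lambda> s\<^sub>\<mu>\<close> in the Schur
  basis.
\<close>

section \<open>Products of series and symmetry\<close>

text \<open>The coordinates come from \<open>D\<close>: it annihilates d = y - x and sends u = x/y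
  to d/y^2, which is why x y D acts as d u d/du. On u^k the recurrence for the operators becomes
  (r+1) a_{r+1} = (k+r) d a_r, and the number of monomials of degree r in k variables obeys the same
  rule. As u is not a polynomial, a polynomial is read as a power series in u whose coefficients are
  series in d; this reading is injective, so operators can be compared through their eigenvalues.
  The objects given by \<open>THE\<close> (fundamental coefficients, \<open>rho\<close>,
  Littlewood-Richardson coefficients) each need existence and uniqueness first. The fundamental and
  Schur expansions are triangular at representative monomials. Products of the h_r are not, since
  every monomial of the right degree occurs in them; generation therefore passes through power sum
  products and Newton's identity, which also yields the counting rule above. Schur functions are
  sums over tableaux, so their symmetry is not visible in the definition and is obtained from the
  Bender-Knuth involution.\<close>

lemma mcoeff_simps [simp]:
  "mcoeff 0 M = 0"
  "mcoeff 1 M = (if M = {#} then 1 else 0)"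
  "mcoeff (f + g) M = mcoeff f M + mcoeff g M"
  "mcoeff (f - g) M = mcoeff f M - mcoeff g M"
  "mcoeff (- f) M = - mcoeff f M"
  "mcoeff (mscale c f) M = c * mcoeff f M"
  by (transfer, simp)+

lemma mcoeff_times: "mcoeff (f * g) M = (\<Sum>(A, B)\<in>mset_splits M. mcoeff f A * mcoeff g B)"
  by transfer simp

lemma mcoeff_sum: "mcoeff (\<Sum>x\<in>A. f x) M = (\<Sum>x\<in>A. mcoeff (f x) M)"
  by (induction A rule: infinite_finite_induct) auto

lemma mcoeff_complete_h [simp]: "mcoeff (complete_h r) M = (if size M = r then 1 else 0)"
  by transfer simp

text \<open>Elimination from the top: if m has maximal weight, no other row reaches column m, so the
  equation at m fixes \<open>c m\<close>, and subtracting row m leaves a system on the rest.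
  Distinct indices of equal weight do not interact, so \<open>w\<close> may have ties.\<close>

lemma triangular_solve:
  fixes A :: "'a \<Rightarrow> 'a \<Rightarrow> rat" and w :: "'a \<Rightarrow> int"
  assumes "finite P"
    and "\<And>i. i \<in> P \<Longrightarrow> A i i \<noteq> 0"
    and "\<And>i j. i \<in> P \<Longrightarrow> j \<in> P \<Longrightarrow> A i j \<noteq> 0 \<Longrightarrow> j = i \<or> w j < w i"
  shows "\<exists>c. \<forall>j\<in>P. (\<Sum>i\<in>P. c i * A i j) = v j"
  using assms
proof (induction P arbitrary: v rule: finite_ranking_induct[where f = w])
  case (insert m P)
  show ?case
  proof (cases "m \<in> P")
    case True
    then show ?thesis using insert by (simp add: insert_absorb)
  next
    case False
    define a where "a = v m / A m m"
    have "\<exists>c. \<forall>j\<in>P. (\<Sum>i\<in>P. c i * A i j) = v j - a * A m j"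
      by (rule insert.IH) (use insert.prems in auto)
    then obtain c where c: "\<And>j. j \<in> P \<Longrightarrow> (\<Sum>i\<in>P. c i * A i j) = v j - a * A m j"
      by blast
    have eq: "(\<Sum>i\<in>insert m P. (c(m := a)) i * A i j) = a * A m j + (\<Sum>i\<in>P. c i * A i j)" for j
      using False insert.hyps(1) by (simp, intro sum.cong) auto
    have "A i m = 0" if "i \<in> P" for i
      using insert.prems(2)[of i m] insert.hyps(2)[of i] that False by fastforce
    then have "(\<Sum>i\<in>insert m P. (c(m := a)) i * A i j) = v j" if "j \<in> insert m P" for j
      using that c insert.prems(1)[of m] unfolding eq by (auto simp: a_def)
    then show ?thesis by blast
  qed
qed simp

lemma triangular_kernel:
  fixes A :: "'a \<Rightarrow> 'a \<Rightarrow> rat" and w :: "'a \<Rightarrow> int"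
  assumes "finite P"
    and "\<And>i. i \<in> P \<Longrightarrow> A i i \<noteq> 0"
    and "\<And>i j. i \<in> P \<Longrightarrow> j \<in> P \<Longrightarrow> A i j \<noteq> 0 \<Longrightarrow> j = i \<or> w j < w i"
    and "\<And>j. j \<in> P \<Longrightarrow> (\<Sum>i\<in>P. c i * A i j) = 0" and "i \<in> P"
  shows "c i = 0"
  using assms
proof (induction P arbitrary: i rule: finite_ranking_induct[where f = w])
  case (insert m P)
  show ?case
  proof (cases "m \<in> P")
    case True
    then show ?thesis using insert by (simp add: insert_absorb)
  next
    case False
    have eq: "(\<Sum>i\<in>insert m P. c i * A i j) = c m * A m j + (\<Sum>i\<in>P. c i * A i j)" for j
      using False insert.hyps(1) by simp
    have "A i m = 0" if "i \<in> P" for i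
      using insert.prems(2)[of i m] insert.hyps(2)[of i] that False by fastforce
    then have cm: "c m = 0"
      using insert.prems(3)[of m] insert.prems(1)[of m] unfolding eq by auto
    have "c i = 0" if "i \<in> P" for i
    proof (rule insert.IH)
      show "(\<Sum>i\<in>P. c i * A i j) = 0" if "j \<in> P" for j
        using insert.prems(3)[of j] cm that unfolding eq by simp
    qed (use insert.prems that in auto)
    then show ?thesis using cm insert.prems(4) by auto
  qed
qed simp

text \<open>The complements of the domain and of the image in \<open>U\<close> have the same size,
  so any bijection between them completes \<open>f\<close>. Finiteness of \<open>U\<close> later
  permits induction on transpositions.\<close>

lemma extend_inj_on_to_permutation:
  fixes f :: "'a \<Rightarrow> 'a"
  assumes "finite A" "inj_on f A"
  shows "\<exists>p U. finite U \<and> p permutes U \<and> (\<forall>x\<in>A. p x = f x)"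
proof -
  define U where "U = A \<union> f ` A"
  have fin: "finite U" using assms by (simp add: U_def)
  have "card (U - A) = card U - card A"
    using assms by (intro card_Diff_subset) (auto simp: U_def)
  moreover have "card (U - f ` A) = card U - card (f ` A)"
    using assms by (intro card_Diff_subset) (auto simp: U_def)
  ultimately have "card (U - A) = card (U - f ` A)" using assms by (simp add: card_image)
  then obtain g where g: "bij_betw g (U - A) (U - f ` A)"
    using fin by (meson finite_Diff finite_same_card_bij)
  define p where "p = (\<lambda>x. if x \<in> A then f x else if x \<in> U then g x else x)"
  have "bij_betw p A (f ` A)"
    using assms(2) by (auto simp: p_def bij_betw_def inj_on_def)
  moreover have "bij_betw p (U - A) (U - f ` A)"
    using g by (rule bij_betw_cong[THEN iffD1, rotated]) (auto simp: p_def)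
  ultimately have "bij_betw p (A \<union> (U - A)) (f ` A \<union> (U - f ` A))"
    by (rule bij_betw_combine) auto
  moreover have "A \<union> (U - A) = U" "f ` A \<union> (U - f ` A) = U" by (auto simp: U_def)
  ultimately have "p permutes U"
    by (intro bij_imp_permutes) (auto simp: p_def U_def)
  then show ?thesis using fin by (intro exI[of _ p] exI[of _ U]) (auto simp: p_def)
qed

text \<open>Only the values of \<phi> on the variables of \<open>M\<close> matter, so that one
  argument serves increasing maps and bijections alike.\<close>

lemma bij_betw_mset_splits:
  assumes "inj_on \<phi> (set_mset M)"
  shows "bij_betw (map_prod (image_mset \<phi>) (image_mset \<phi>)) (mset_splits M)
           (mset_splits (image_mset \<phi> M))"
proof -
  let ?\<psi> = "inv_into (set_mset M) \<phi>"
  have inv: "image_mset ?\<psi> (image_mset \<phi> A) = A" if "A \<subseteq># M" for A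
  proof -
    have "image_mset ?\<psi> (image_mset \<phi> A) = image_mset id A"
      unfolding multiset.map_comp
      by (rule image_mset_cong) (use that assms in \<open>auto dest: mset_subset_eqD\<close>)
    then show ?thesis by simp
  qed
  have inv': "image_mset \<phi> (image_mset ?\<psi> B) = B" if "B \<subseteq># image_mset \<phi> M" for B
  proof -
    have "image_mset \<phi> (image_mset ?\<psi> B) = image_mset id B"
      unfolding multiset.map_comp
    proof (rule image_mset_cong)
      fix x assume "x \<in># B"
      then have "x \<in> \<phi> ` set_mset M" using that by (metis mset_subset_eqD set_image_mset)
      then show "(\<phi> \<circ> ?\<psi>) x = id x" by (simp add: f_inv_into_f)
    qed
    then show ?thesis by simp
  qed
  show ?thesis
  proof (rule bij_betw_byWitness[where f' = "map_prod (image_mset ?\<psi>) (image_mset ?\<psi>)"])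
    have "A \<subseteq># M" "B \<subseteq># M" if "(A, B) \<in> mset_splits M" for A B
      using that by (auto simp: mset_splits_def)
    then show "\<forall>a\<in>mset_splits M. map_prod (image_mset ?\<psi>) (image_mset ?\<psi>)
        (map_prod (image_mset \<phi>) (image_mset \<phi>) a) = a"
      by (auto simp: inv simp del: multiset.map_comp)
    have "A \<subseteq># image_mset \<phi> M" "B \<subseteq># image_mset \<phi> M"
      if "(A, B) \<in> mset_splits (image_mset \<phi> M)" for A B
      using that by (auto simp: mset_splits_def) (metis mset_subset_eq_add_left mset_subset_eq_add_right)+
    then show "\<forall>a\<in>mset_splits (image_mset \<phi> M). map_prod (image_mset \<phi>) (image_mset \<phi>)
        (map_prod (image_mset ?\<psi>) (image_mset ?\<psi>) a) = a"
      by (auto simp: inv' simp del: multiset.map_comp)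
    show "map_prod (image_mset \<phi>) (image_mset \<phi>) ` mset_splits M
        \<subseteq> mset_splits (image_mset \<phi> M)"
      by (auto simp: mset_splits_def)
    show "map_prod (image_mset ?\<psi>) (image_mset ?\<psi>) ` mset_splits (image_mset \<phi> M)
        \<subseteq> mset_splits M"
      unfolding mset_splits_def using inv[of M] by (auto simp flip: image_mset_union)
  qed
qed

lemma mcoeff_times_image_mset:
  assumes "inj_on \<phi> (set_mset M)"
    and "\<And>A. A \<subseteq># M \<Longrightarrow> mcoeff f (image_mset \<phi> A) = mcoeff f A"
    and "\<And>A. A \<subseteq># M \<Longrightarrow> mcoeff g (image_mset \<phi> A) = mcoeff g A"
  shows "mcoeff (f * g) (image_mset \<phi> M) = mcoeff (f * g) M"
  unfolding mcoeff_times sum.reindex_bij_betw[OF bij_betw_mset_splits[OF assms(1)], symmetric]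
  by (rule sum.cong) (auto simp: mset_splits_def assms(2,3))

lemma mcoeff_times_nonzeroE:
  assumes "mcoeff (f * g) M \<noteq> 0"
  obtains A B where "M = A + B" "mcoeff f A \<noteq> 0" "mcoeff g B \<noteq> 0"
proof -
  have "\<exists>p\<in>mset_splits M. (case p of (A, B) \<Rightarrow> mcoeff f A * mcoeff g B) \<noteq> 0"
    using assms unfolding mcoeff_times by (metis (no_types, lifting) sum.neutral)
  then show ?thesis using that by (auto simp: mset_splits_def)
qed

lemma homogeneous_times:
  assumes "homogeneous m f" "homogeneous n g"
  shows "homogeneous (m + n) (f * g)"
  unfolding homogeneous_def
proof (intro allI impI)
  fix M assume "mcoeff (f * g) M \<noteq> 0"
  then obtain A B where "M = A + B" "mcoeff f A \<noteq> 0" "mcoeff g B \<noteq> 0"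
    by (rule mcoeff_times_nonzeroE)
  with assms show "size M = m + n" by (auto simp: homogeneous_def)
qed

lemma quasisymmetric_times:
  assumes "quasisymmetric f" "quasisymmetric g"
  shows "quasisymmetric (f * g)"
  unfolding quasisymmetric_def
proof (intro allI impI)
  fix M and \<phi> :: "nat \<Rightarrow> nat" assume mono: "strict_mono_on (set_mset M) \<phi>"
  have "strict_mono_on (set_mset A) \<phi>" if "A \<subseteq># M" for A
    using that mono by (meson monotone_on_subset set_mset_mono)
  then show "mcoeff (f * g) (image_mset \<phi> M) = mcoeff (f * g) M"
    using assms mono
    by (intro mcoeff_times_image_mset) (auto simp: quasisymmetric_def strict_mono_on_imp_inj_on)
qed

lemma mcoeff_Sym_image:
  assumes "f \<in> Sym" "inj_on \<phi> (set_mset M)"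
  shows "mcoeff f (image_mset \<phi> M) = mcoeff f M"
proof -
  obtain p U where p: "p permutes U" "\<forall>x\<in>set_mset M. p x = \<phi> x"
    using extend_inj_on_to_permutation[OF finite_set_mset assms(2)] by blast
  then have "image_mset \<phi> M = image_mset p M" by (intro image_mset_cong) auto
  moreover have "bij p" using p(1) by (rule permutes_bij)
  ultimately show ?thesis using assms(1) by (simp add: Sym_def)
qed

lemma Sym_imp_quasisymmetric: "f \<in> Sym \<Longrightarrow> quasisymmetric f"
  unfolding quasisymmetric_def by (blast intro: mcoeff_Sym_image strict_mono_on_imp_inj_on)

lemma Sym_deg_times_QSym:
  "g \<in> Sym_deg m \<Longrightarrow> f \<in> QSym N \<Longrightarrow> g * f \<in> QSym (N + m)"
  using homogeneous_times[of m g N f]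
  by (auto simp: Sym_deg_def QSym_def add.commute intro: quasisymmetric_times Sym_imp_quasisymmetric)

section \<open>Closure properties of the symmetric functions\<close>

lemma homogeneous_Sym_degI:
  "homogeneous n f \<Longrightarrow> (\<And>\<pi> M. bij \<pi> \<Longrightarrow> mcoeff f (image_mset \<pi> M) = mcoeff f M) \<Longrightarrow> f \<in> Sym_deg n"
  by (auto simp: Sym_deg_def Sym_def homogeneous_def)

lemma SymI:
  assumes "\<And>\<pi> M. bij \<pi> \<Longrightarrow> mcoeff f (image_mset \<pi> M) = mcoeff f M"
    and "\<And>M. mcoeff f M \<noteq> 0 \<Longrightarrow> size M \<le> d"
  shows "f \<in> Sym"
  using assms by (auto simp: Sym_def)

lemma Sym_bound: "f \<in> Sym \<Longrightarrow> \<exists>d. \<forall>M. mcoeff f M \<noteq> 0 \<longrightarrow> size M \<le> d"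
  by (simp add: Sym_def)

lemma Sym_perm: "f \<in> Sym \<Longrightarrow> bij \<pi> \<Longrightarrow> mcoeff f (image_mset \<pi> M) = mcoeff f M"
  by (simp add: Sym_def)

lemma Sym_mscale [intro]: "f \<in> Sym \<Longrightarrow> mscale c f \<in> Sym"
  by (auto simp: Sym_def)

lemma Sym_add [intro]:
  assumes "f \<in> Sym" "g \<in> Sym"
  shows "f + g \<in> Sym"
proof -
  obtain a b where "\<forall>M. mcoeff f M \<noteq> 0 \<longrightarrow> size M \<le> a" "\<forall>M. mcoeff g M \<noteq> 0 \<longrightarrow> size M \<le> b"
    using Sym_bound[OF assms(1)] Sym_bound[OF assms(2)] by blast
  then have "size M \<le> max a b" if "mcoeff (f + g) M \<noteq> 0" for M
    using that by (cases "mcoeff f M = 0") (auto simp: le_max_iff_disj)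
  then show ?thesis using assms by (intro SymI[where d = "max a b"]) (simp_all only: Sym_perm mcoeff_simps)
qed

lemma Sym_times [intro]:
  assumes "f \<in> Sym" "g \<in> Sym"
  shows "f * g \<in> Sym"
proof -
  obtain a b where ab: "\<forall>M. mcoeff f M \<noteq> 0 \<longrightarrow> size M \<le> a" "\<forall>M. mcoeff g M \<noteq> 0 \<longrightarrow> size M \<le> b"
    using Sym_bound[OF assms(1)] Sym_bound[OF assms(2)] by blast
  have "size M \<le> a + b" if "mcoeff (f * g) M \<noteq> 0" for M
  proof -
    from that obtain A B where "M = A + B" "mcoeff f A \<noteq> 0" "mcoeff g B \<noteq> 0"
      by (rule mcoeff_times_nonzeroE)
    with ab show ?thesis by (metis add_mono size_union)
  qed
  moreover have "mcoeff (f * g) (image_mset \<pi> M) = mcoeff (f * g) M" if "bij \<pi>" for \<pi> M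
    using that assms
    by (intro mcoeff_times_image_mset) (auto simp: Sym_perm dest: bij_is_inj intro: inj_on_subset)
  ultimately show ?thesis by (rule SymI[rotated])
qed

lemma Sym_0 [simp, intro]: "0 \<in> Sym"
  by (auto simp: Sym_def)

lemma Sym_1 [simp, intro]: "1 \<in> Sym"
  by (auto simp: Sym_def)

lemma Sym_sum [intro]: "(\<And>x. x \<in> A \<Longrightarrow> f x \<in> Sym) \<Longrightarrow> (\<Sum>x\<in>A. f x) \<in> Sym"
  by (induction A rule: infinite_finite_induct) auto

lemma complete_h_Sym [simp, intro]: "complete_h r \<in> Sym"
  by (auto simp: Sym_def)

lemma Sym_deg_imp_Sym: "f \<in> Sym_deg n \<Longrightarrow> f \<in> Sym"
  by (simp add: Sym_deg_def)

section \<open>Principal specialisation\<close>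

unbundle fps_syntax

definition monomials :: "nat \<Rightarrow> nat \<Rightarrow> nat multiset set" where
  "monomials k n = {M. set_mset M \<subseteq> {..<k} \<and> size M = n}"

lemma finite_monomials [simp]: "finite (monomials k n)"
proof -
  have "monomials k n \<subseteq> mset ` {xs. set xs \<subseteq> {..<k} \<and> length xs = n}"
  proof
    fix M assume "M \<in> monomials k n"
    moreover obtain xs where "mset xs = M" using ex_mset by blast
    ultimately show "M \<in> mset ` {xs. set xs \<subseteq> {..<k} \<and> length xs = n}"
      by (auto simp: monomials_def)
  qed
  then show ?thesis by (rule finite_subset) (simp add: finite_lists_length_eq)
qed

text \<open>The series \<open>f(d, \<dots>, d, 0, 0, \<dots>)\<close> in \<open>d\<close>, with \<open>k\<close> nonzero arguments.\<close>

definition principal_spec :: "nat \<Rightarrow> mseries \<Rightarrow> rat fps" where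
  "principal_spec k f = Abs_fps (\<lambda>n. \<Sum>M\<in>monomials k n. mcoeff f M)"

lemma principal_spec_add [simp]: "principal_spec k (f + g) = principal_spec k f + principal_spec k g"
  by (simp add: principal_spec_def fps_eq_iff sum.distrib)

lemma principal_spec_mscale [simp]: "principal_spec k (mscale c f) = fps_const c * principal_spec k f"
  by (simp add: principal_spec_def fps_eq_iff sum_distrib_left)

lemma principal_spec_sum: "principal_spec k (\<Sum>x\<in>A. f x) = (\<Sum>x\<in>A. principal_spec k (f x))"
proof (induction A rule: infinite_finite_induct)
  case (insert x A)
  then show ?case by (simp del: principal_spec_add add: principal_spec_add[of k "f x" "sum f A"])
qed (auto simp: principal_spec_def fps_eq_iff)

text \<open>A monomial in k variables splits into two monomials in the same variables whose degrees
  add up; sorting the splits by degree is the Cauchy product.\<close>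

lemma principal_spec_times [simp]: "principal_spec k (f * g) = principal_spec k f * principal_spec k g"
proof (rule fps_ext)
  fix n
  have "principal_spec k (f * g) $ n =
      (\<Sum>(M, A, B)\<in>(SIGMA M:monomials k n. mset_splits M). mcoeff f A * mcoeff g B)"
    by (subst sum.Sigma[symmetric]) (auto simp: principal_spec_def mcoeff_times case_prod_unfold)
  also have "\<dots> = (\<Sum>(i, A, B)\<in>(SIGMA i:{0..n}. monomials k i \<times> monomials k (n - i)).
      mcoeff f A * mcoeff g B)"
    by (rule sum.reindex_bij_witness[of _ "\<lambda>(i, A, B). (A + B, A, B)" "\<lambda>(M, A, B). (size A, A, B)"])
      (auto simp: mset_splits_def monomials_def)
  also have "\<dots> = (\<Sum>i=0..n. \<Sum>A\<in>monomials k i. \<Sum>B\<in>monomials k (n - i). mcoeff f A * mcoeff g B)"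
    by (subst sum.Sigma[symmetric]) (auto simp: sum.cartesian_product)
  also have "\<dots> = (principal_spec k f * principal_spec k g) $ n"
    by (simp add: fps_mult_nth principal_spec_def sum_product)
  finally show "principal_spec k (f * g) $ n = (principal_spec k f * principal_spec k g) $ n" .
qed

lemma principal_spec_homogeneous:
  assumes "homogeneous n f"
  shows "principal_spec k f = fps_const (\<Sum>M\<in>monomials k n. mcoeff f M) * fps_X ^ n"
proof (rule fps_ext)
  fix i
  have "(\<Sum>M\<in>monomials k i. mcoeff f M) = 0" if "i \<noteq> n"
    using assms that by (intro sum.neutral) (auto simp: homogeneous_def monomials_def)
  then show "principal_spec k f $ i = (fps_const (\<Sum>M\<in>monomials k n. mcoeff f M) * fps_X ^ n) $ i"
    by (auto simp: principal_spec_def)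
qed

section \<open>Power sums, Newton's identity and the number of monomials\<close>

lift_definition power_sum :: "nat \<Rightarrow> mseries" is
  "\<lambda>r M. if \<exists>x. M = replicate_mset r x then 1 else 0" .

lemma mcoeff_power_sum [simp]:
  "mcoeff (power_sum r) M = (if \<exists>x. M = replicate_mset r x then 1 else 0)"
  by transfer simp

lemma homogeneous_power_sum: "homogeneous r (power_sum r)"
  by (auto simp: homogeneous_def)

lemma homogeneous_complete_h: "homogeneous r (complete_h r)"
  by (auto simp: homogeneous_def)

lemma power_sum_Sym [simp, intro]: "power_sum r \<in> Sym"
proof (rule SymI)
  fix \<pi> :: "nat \<Rightarrow> nat" and M assume "bij \<pi>"
  then have inj: "inj (image_mset \<pi>)" and surj: "surj \<pi>"
    by (auto simp: bij_def intro: multiset.inj_map)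
  have "(\<exists>x. image_mset \<pi> M = replicate_mset r x) \<longleftrightarrow> (\<exists>x. image_mset \<pi> M = replicate_mset r (\<pi> x))"
    using surj by (metis surjD)
  also have "\<dots> \<longleftrightarrow> (\<exists>x. M = replicate_mset r x)"
    using inj by (auto dest: injD simp flip: image_replicate_mset)
  finally show "mcoeff (power_sum r) (image_mset \<pi> M) = mcoeff (power_sum r) M" by simp
next
  show "size M \<le> r" if "mcoeff (power_sum r) M \<noteq> 0" for M
    using that by (auto split: if_splits)
qed

text \<open>If \<open>M\<close> has size n, its coefficient in
  \<open>power_sum i * complete_h (n - i)\<close> is the number of variables whose exponent in
  \<open>M\<close> is at least i. Summing over i counts each variable as often as its exponent,
  hence n in total.\<close>

lemma newton_complete_h:
  "mscale (of_nat n) (complete_h n) = (\<Sum>i=1..n. power_sum i * complete_h (n - i))"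
proof (rule mseries_eqI)
  fix M
  have eq: "mcoeff (power_sum i * complete_h (n - i)) M
      = (if size M = n then of_nat (card {x. i \<le> count M x}) else 0)" if i: "i \<in> {1..n}" for i
  proof -
    let ?S = "{(A, B) \<in> mset_splits M. (\<exists>x. A = replicate_mset i x) \<and> size B = n - i}"
    have "mcoeff (power_sum i * complete_h (n - i)) M = (\<Sum>p\<in>?S. 1)"
      unfolding mcoeff_times by (rule sum.mono_neutral_cong_right) (auto split: if_splits)
    also have "\<dots> = of_nat (card ?S)" by simp
    also have "card ?S = (if size M = n then card {x. i \<le> count M x} else 0)"
    proof (cases "size M = n")
      case True
      have "bij_betw (\<lambda>x. (replicate_mset i x, M - replicate_mset i x)) {x. i \<le> count M x} ?S"
      proof (rule bij_betw_imageI)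
        show "inj_on (\<lambda>x. (replicate_mset i x, M - replicate_mset i x)) {x. i \<le> count M x}"
          using i by (auto simp: inj_on_def replicate_mset_eq_iff)
        show "(\<lambda>x. (replicate_mset i x, M - replicate_mset i x)) ` {x. i \<le> count M x} = ?S"
        proof (intro set_eqI iffI)
          fix p assume "p \<in> (\<lambda>x. (replicate_mset i x, M - replicate_mset i x)) ` {x. i \<le> count M x}"
          then obtain x where "replicate_mset i x \<subseteq># M" "p = (replicate_mset i x, M - replicate_mset i x)"
            by (auto simp: count_le_replicate_mset_subset_eq)
          then show "p \<in> ?S" using True by (auto simp: mset_splits_def size_Diff_submset)
        next
          fix p assume "p \<in> ?S"
          then obtain x B where p: "p = (replicate_mset i x, B)" "M = replicate_mset i x + B"
            by (auto simp: mset_splits_def)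
          then have "i \<le> count M x" "B = M - replicate_mset i x" by auto
          then show "p \<in> (\<lambda>x. (replicate_mset i x, M - replicate_mset i x)) ` {x. i \<le> count M x}"
            using p(1) by blast
        qed
      qed
      then show ?thesis using True by (simp add: bij_betw_same_card)
    next
      case False
      then have "?S = {}" using i by (auto simp: mset_splits_def)
      then show ?thesis using False by (simp only: card.empty if_False)
    qed
    finally show ?thesis by (simp only: of_nat_0 if_distrib[of of_nat])
  qed
  have "(\<Sum>i=1..n. card {x. i \<le> count M x}) = n" if "size M = n"
  proof -
    have "x \<in># M" if "1 \<le> i" "i \<le> count M x" for i x
      using that by (metis count_eq_zero_iff le_zero_eq not_one_le_zero)
    then have "(\<Sum>i=1..n. card {x. i \<le> count M x}) = (\<Sum>i=1..n. card {x\<in>set_mset M. i \<le> count M x})"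
      by (intro sum.cong arg_cong[where f = card]) auto
    also have "\<dots> = card (SIGMA i:{1..n}. {x\<in>set_mset M. i \<le> count M x})"
      by (simp add: card_SigmaI)
    also have "\<dots> = card (SIGMA x:set_mset M. {1..count M x})"
    proof (rule bij_betw_same_card[of prod.swap], rule bij_betw_imageI)
      have "i \<le> n" if "i \<le> count M x" for i x
        using that \<open>size M = n\<close> count_le_size[of M x] by linarith
      then show "prod.swap ` (SIGMA i:{1..n}. {x\<in>set_mset M. i \<le> count M x})
          = (SIGMA x:set_mset M. {1..count M x})"
        by (auto simp: image_iff)
    qed simp
    also have "\<dots> = n" using that by (simp add: card_SigmaI size_multiset_overloaded_eq)
    finally show ?thesis .
  qed
  then have "mcoeff (mscale (of_nat n) (complete_h n)) M
      = (\<Sum>i=1..n. if size M = n then of_nat (card {x. i \<le> count M x}) else 0)"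
    by (auto simp flip: of_nat_sum)
  then show "mcoeff (mscale (of_nat n) (complete_h n)) M
      = mcoeff (\<Sum>i=1..n. power_sum i * complete_h (n - i)) M"
    by (simp add: mcoeff_sum eq)
qed

text \<open>This is the multiset coefficient, k + r - 1 choose r; it enters only through its value
  at r = 0 and its recurrence.\<close>

definition hcount :: "nat \<Rightarrow> nat \<Rightarrow> nat" where
  "hcount k r = card (monomials k r)"

lemma principal_spec_complete_h: "principal_spec k (complete_h r) = fps_const (of_nat (hcount k r)) * fps_X ^ r"
proof -
  have "(\<Sum>M\<in>monomials k r. mcoeff (complete_h r) M) = (\<Sum>M\<in>monomials k r. 1)"
    by (rule sum.cong) (auto simp: monomials_def)
  then show ?thesis by (simp add: principal_spec_homogeneous[OF homogeneous_complete_h] hcount_def)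
qed

text \<open>Positivity matters: \<open>power_sum 0\<close> is 1, which specialises to 1 and not to
  k.\<close>

lemma principal_spec_power_sum:
  assumes "r > 0"
  shows "principal_spec k (power_sum r) = fps_const (of_nat k) * fps_X ^ r"
proof -
  have "(\<Sum>M\<in>monomials k r. mcoeff (power_sum r) M) = (\<Sum>M\<in>replicate_mset r ` {..<k}. 1)"
  proof (rule sum.mono_neutral_cong_right)
    show "\<forall>M\<in>monomials k r - replicate_mset r ` {..<k}. mcoeff (power_sum r) M = 0"
    proof
      fix M assume M: "M \<in> monomials k r - replicate_mset r ` {..<k}"
      have "M \<noteq> replicate_mset r x" for x
      proof
        assume eq: "M = replicate_mset r x"
        with M assms have "x < k" by (simp add: monomials_def)
        with eq M show False by blast
      qed
      then show "mcoeff (power_sum r) M = 0" by simp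
    qed
    show "replicate_mset r ` {..<k} \<subseteq> monomials k r"
      by (auto simp: monomials_def split: if_splits)
  qed auto
  also have "\<dots> = of_nat k"
    using assms by (simp add: card_image inj_on_def replicate_mset_eq_iff)
  finally show ?thesis by (simp add: principal_spec_homogeneous[OF homogeneous_power_sum])
qed

lemma hcount_0 [simp]: "hcount k 0 = 1"
proof -
  have "monomials k 0 = {{#}}" by (auto simp: monomials_def)
  then show ?thesis by (simp add: hcount_def)
qed

text \<open>At k equal arguments Newton's identity says that n times the n-th count is k times the
  sum of the earlier ones; the difference of two consecutive instances is this recurrence.\<close>

lemma hcount_Suc: "Suc r * hcount k (Suc r) = (k + r) * hcount k r"
proof -
  have newton: "n * hcount k n = k * (\<Sum>i<n. hcount k i)" for n
  proof -
    have "fps_const (of_nat (n * hcount k n)) * fps_X ^ n = principal_spec k (mscale (of_nat n) (complete_h n))"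
      by (simp add: principal_spec_complete_h flip: fps_const_mult mult.assoc)
    also have "\<dots> = (\<Sum>i=1..n. fps_const (of_nat k) * fps_X ^ i
        * (fps_const (of_nat (hcount k (n - i))) * fps_X ^ (n - i)))"
      unfolding newton_complete_h principal_spec_sum
      by (rule sum.cong) (auto simp: principal_spec_complete_h principal_spec_power_sum)
    also have "\<dots> = (\<Sum>i=1..n. fps_const (of_nat (k * hcount k (n - i))) * fps_X ^ n)"
      by (rule sum.cong) (auto simp: ac_simps power_add[symmetric] simp flip: fps_const_mult)
    also have "\<dots> = (\<Sum>i<n. fps_const (of_nat (k * hcount k i)) * fps_X ^ n)"
      by (rule sum.reindex_bij_witness[of _ "\<lambda>i. n - i" "\<lambda>i. n - i"]) auto
    finally have "(fps_const (of_nat (n * hcount k n)) * fps_X ^ n) $ n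
        = (\<Sum>i<n. fps_const (of_nat (k * hcount k i) :: rat) * fps_X ^ n) $ n" by simp
    then have "of_nat (n * hcount k n) = (of_nat (\<Sum>i<n. k * hcount k i) :: rat)"
      by (simp add: fps_sum_nth)
    then show ?thesis by (simp only: of_nat_eq_iff sum_distrib_left)
  qed
  show ?thesis using newton[of r] newton[of "Suc r"] by (simp add: algebra_simps)
qed

section \<open>Diagonalisation of the operators\<close>

abbreviation pcoeff :: "poly_xy \<Rightarrow> nat \<Rightarrow> nat \<Rightarrow> rat" where
  "pcoeff p a b \<equiv> coeff (coeff p a) b"

lemma poly_xy_eqI: "(\<And>a b. pcoeff p a b = pcoeff q a b) \<Longrightarrow> p = q"
  by (simp add: poly_eq_iff)

lemma pcoeff_scale_xy [simp]: "pcoeff (scale_xy c p) a b = c * pcoeff p a b"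
  by (simp add: scale_xy_def)

lemma pcoeff_X_times: "pcoeff (X * p) a b = (if a = 0 then 0 else pcoeff p (a - 1) b)"
  by (cases a) (auto simp: X_def)

lemma pcoeff_Y_times: "pcoeff (Y * p) a b = (if b = 0 then 0 else pcoeff p a (b - 1))"
  by (cases b) (auto simp: Y_def)

lemma pcoeff_D:
  "pcoeff (D p) a b = of_nat (a + 1) * pcoeff p (a + 1) b + of_nat (b + 1) * pcoeff p a (b + 1)"
proof -
  have "coeff (of_nat n * q) b = of_nat n * coeff q b" for n and q :: "rat poly"
    by (simp add: of_nat_poly)
  then show ?thesis
    by (simp add: D_def coeff_pderiv coeff_map_poly del: of_nat_add of_nat_Suc)
qed

lemma pcoeff_X_power_Y_power: "pcoeff (X ^ i * Y ^ j) a b = (if a = i \<and> b = j then 1 else 0)"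
proof (induction i arbitrary: a)
  case 0
  show ?case
  proof (induction j arbitrary: b)
    case 0
    show ?case by (simp add: coeff_1)
  next
    case (Suc j)
    then show ?case by (auto simp: pcoeff_Y_times)
  qed
next
  case (Suc i)
  then show ?case by (auto simp: pcoeff_X_times mult.assoc)
qed

lemma scale_xy_simps:
  "scale_xy c (p + q) = scale_xy c p + scale_xy c q"
  "scale_xy (c + d) p = scale_xy c p + scale_xy d p"
  "scale_xy c (scale_xy d p) = scale_xy (c * d) p"
  "scale_xy 1 p = p"
  "scale_xy 0 p = 0"
  "scale_xy c (p * q) = scale_xy c p * q"
  by (simp_all add: scale_xy_def smult_add_right one_pCons[symmetric] mult.commute flip: smult_add_left)

lemma scale_xy_mult_right: "p * scale_xy c q = scale_xy c (p * q)"
  by (simp add: scale_xy_def)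

lemma vector_space_scale_xy: "vector_space scale_xy"
  by unfold_locales (simp_all add: scale_xy_simps)

interpretation scale_xy: vector_space scale_xy
  by (rule vector_space_scale_xy)

text \<open>
  Since \<open>x = u d / (1 - u)\<close> and \<open>y = d / (1 - u)\<close>, the part of degree \<open>n\<close> of \<open>p\<close> is
  \<open>d\<^sup>n\<close> times \<open>ud_slice n p\<close>, a power series in \<open>u\<close>; and \<open>ud_coeff p k\<close> is the coefficient
  of \<open>u\<^sup>k\<close> in \<open>p\<close>, a power series in \<open>d\<close>.
\<close>

definition dehomog :: "nat \<Rightarrow> poly_xy \<Rightarrow> rat fps" where
  "dehomog n p = Abs_fps (\<lambda>a. if a \<le> n then pcoeff p a (n - a) else 0)"

definition geometric :: "rat fps" where
  "geometric = inverse (1 - fps_X)"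

lemma geometric_times: "(1 - fps_X) * geometric = 1"
  unfolding geometric_def by (rule inverse_mult_eq_1') simp

lemma fps_deriv_geometric: "fps_deriv geometric = geometric\<^sup>2"
  unfolding geometric_def by (subst fps_inverse_deriv) auto

lemma fps_deriv_geometric_power: "fps_deriv (geometric ^ m) = fps_const (of_nat m) * geometric ^ Suc m"
  by (induction m) (simp_all add: fps_deriv_geometric power2_eq_square algebra_simps flip: fps_const_add)

text \<open>A form q of degree n satisfies q(x, y) = y^n q(x/y, 1), and y^n = d^n / (1 - u)^n:
  \<open>dehomog\<close> supplies q(u, 1) and \<open>geometric\<close> the denominator.\<close>

definition ud_slice :: "nat \<Rightarrow> poly_xy \<Rightarrow> rat fps" where
  "ud_slice n p = dehomog n p * geometric ^ n"

definition ud_coeff :: "poly_xy \<Rightarrow> nat \<Rightarrow> rat fps" where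
  "ud_coeff p k = Abs_fps (\<lambda>n. ud_slice n p $ k)"

text \<open>Multiplication by (1 - u)^n recovers \<open>dehomog n p\<close>, and with it every
  coefficient of \<open>p\<close>. Operator identities thereby become identities between power
  series in d.\<close>

lemma ud_coeff_inject:
  assumes "\<And>k. ud_coeff p k = ud_coeff q k"
  shows "p = q"
proof (rule poly_xy_eqI)
  fix a b
  have "ud_slice n p = ud_slice n q" for n
    using assms by (simp add: ud_coeff_def fps_eq_iff)
  moreover have "dehomog n r = (1 - fps_X) ^ n * ud_slice n r" for n r
    by (metis (no_types, lifting) geometric_times mult.commute mult.left_commute mult.right_neutral
        power_mult_distrib power_one ud_slice_def)
  ultimately have "dehomog (a + b) p $ a = dehomog (a + b) q $ a" by simp
  then show "pcoeff p a b = pcoeff q a b" by (simp add: dehomog_def)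
qed

lemma dehomog_add: "dehomog n (p + q) = dehomog n p + dehomog n q"
  by (simp add: dehomog_def fps_eq_iff)

lemma dehomog_scale: "dehomog n (scale_xy c p) = fps_const c * dehomog n p"
  by (simp add: dehomog_def fps_eq_iff)

lemma ud_coeff_add [simp]: "ud_coeff (p + q) k = ud_coeff p k + ud_coeff q k"
  by (simp add: ud_coeff_def fps_eq_iff ud_slice_def dehomog_add ring_distribs)

lemma ud_coeff_scale [simp]: "ud_coeff (scale_xy c p) k = fps_const c * ud_coeff p k"
  by (simp add: ud_coeff_def fps_eq_iff ud_slice_def dehomog_scale mult.assoc)

lemma ud_coeff_0 [simp]: "ud_coeff 0 k = 0"
  using ud_coeff_scale[of 0 0 k] by (simp add: scale_xy_simps)

lemma ud_coeff_sum: "ud_coeff (\<Sum>x\<in>A. f x) k = (\<Sum>x\<in>A. ud_coeff (f x) k)"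
  by (induction A rule: infinite_finite_induct) auto

text \<open>Dehomogenised, y - x is 1 - u, which cancels one factor \<open>geometric\<close>; the
  rise in degree leaves the factor d.\<close>

lemma ud_coeff_Y_minus_X: "ud_coeff ((Y - X) * p) k = fps_X * ud_coeff p k"
proof (rule fps_ext)
  fix n
  show "ud_coeff ((Y - X) * p) k $ n = (fps_X * ud_coeff p k) $ n"
  proof (cases n)
    case 0
    have "dehomog 0 ((Y - X) * p) = 0"
      by (auto simp: dehomog_def fps_eq_iff left_diff_distrib pcoeff_X_times pcoeff_Y_times)
    then show ?thesis using 0 by (simp add: ud_coeff_def ud_slice_def)
  next
    case (Suc m)
    have "dehomog (Suc m) ((Y - X) * p) = (1 - fps_X) * dehomog m p"
      by (rule fps_ext)
        (auto simp: dehomog_def left_diff_distrib pcoeff_X_times pcoeff_Y_times Suc_diff_le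
          not_less_eq_eq fps_X_mult_nth)
    then have "ud_slice (Suc m) ((Y - X) * p) = ((1 - fps_X) * geometric) * ud_slice m p"
      by (simp add: ud_slice_def ac_simps)
    then show ?thesis using Suc by (simp add: geometric_times ud_coeff_def)
  qed
qed

lemma ud_coeff_XYD: "ud_coeff (X * Y * D p) k = fps_const (of_nat k) * fps_X * ud_coeff p k"
proof (rule fps_ext)
  fix n
  show "ud_coeff (X * Y * D p) k $ n = (fps_const (of_nat k) * fps_X * ud_coeff p k) $ n"
  proof (cases n)
    case 0
    have "dehomog 0 (X * Y * D p) = 0"
      by (auto simp: dehomog_def fps_eq_iff mult.assoc pcoeff_X_times pcoeff_Y_times)
    then show ?thesis using 0 by (simp add: ud_coeff_def ud_slice_def)
  next
    case (Suc m)
    let ?P = "dehomog m p"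
    \<comment> \<open>For a form q of degree m with P = q(u, 1), the x-derivative gives P' and, by
      Euler's relation, the y-derivative gives m P - u P'. The factor x y contributes u.\<close>
    have A: "dehomog (Suc m) (X * Y * D p)
        = fps_X * ((1 - fps_X) * fps_deriv ?P + fps_const (of_nat m) * ?P)"
    proof (rule fps_ext)
      fix a
      show "dehomog (Suc m) (X * Y * D p) $ a
        = (fps_X * ((1 - fps_X) * fps_deriv ?P + fps_const (of_nat m) * ?P)) $ a"
      proof (cases a)
        case 0
        then show ?thesis by (simp add: dehomog_def mult.assoc pcoeff_X_times)
      next
        case (Suc c)
        consider "c < m" | "c = m" | "c > m" by linarith
        then show ?thesis
        proof cases
          case 1
          then obtain e where m: "m = Suc (c + e)" using less_imp_Suc_add by blast
          show ?thesis
            by (cases c) (auto simp: m Suc dehomog_def mult.assoc pcoeff_X_times pcoeff_Y_times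
                pcoeff_D left_diff_distrib fps_X_mult_nth algebra_simps)
        next
          \<comment> \<open>At the top coefficient \<open>Y\<close> makes the left side vanish; on
            the right m P_m cancels against the contribution of -u P'.\<close>
          case 2
          then show ?thesis
            by (cases c) (auto simp: Suc dehomog_def mult.assoc pcoeff_X_times pcoeff_Y_times
                pcoeff_D left_diff_distrib fps_X_mult_nth algebra_simps)
        next
          case 3
          then show ?thesis
            by (cases c) (auto simp: Suc dehomog_def left_diff_distrib fps_X_mult_nth)
        qed
      qed
    qed
    have B: "fps_deriv (ud_slice m p)
        = fps_deriv ?P * geometric ^ m + fps_const (of_nat m) * ?P * geometric ^ Suc m"
      by (simp add: ud_slice_def fps_deriv_geometric_power algebra_simps)
    \<comment> \<open>A factor (1 - u) / (1 - u) brings the first summand of \<open>B\<close> to the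
      power \<open>Suc m\<close> as well.\<close>
    have C: "fps_deriv ?P * geometric ^ m = (1 - fps_X) * fps_deriv ?P * geometric ^ Suc m"
      using geometric_times by (metis (no_types, lifting) mult.assoc mult.commute mult.right_neutral power_Suc)
    have "ud_slice (Suc m) (X * Y * D p) = fps_X * fps_deriv (ud_slice m p)"
      unfolding ud_slice_def[of "Suc m"] A B C by (simp only: algebra_simps)
    then show ?thesis using Suc
      by (cases k) (simp_all add: ud_coeff_def mult.assoc)
  qed
qed

section \<open>The product rule for \<open>D\<close> and the recurrence for \<open>G\<close>\<close>

lemma D_X_times: "D (X * p) = p + X * D p"
  by (rule poly_xy_eqI) (auto simp: pcoeff_D pcoeff_X_times algebra_simps)

lemma D_Y_times: "D (Y * p) = p + Y * D p"
  by (rule poly_xy_eqI) (auto simp: pcoeff_D pcoeff_Y_times algebra_simps)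

lemma D_add: "D (p + q) = D p + D q"
  by (rule poly_xy_eqI) (auto simp: pcoeff_D algebra_simps)

lemma D_scale_xy: "D (scale_xy c p) = scale_xy c (D p)"
  by (rule poly_xy_eqI) (auto simp: pcoeff_D algebra_simps)

lemma D_sum: "D (\<Sum>x\<in>A. f x) = (\<Sum>x\<in>A. D (f x))"
proof (induction A rule: infinite_finite_induct)
  case (insert x A)
  then show ?case by (simp add: D_add)
qed (use D_scale_xy[of 0 0] in simp_all)

lemma X_D_X_power: "X * D (X ^ j * p) = scale_xy (of_nat j) (X ^ j * p) + X ^ Suc j * D p"
  by (induction j) (simp_all add: D_X_times mult.assoc ring_distribs scale_xy_simps scale_xy_mult_right)

lemma Y_D_Y_power: "Y * D (Y ^ j * p) = scale_xy (of_nat j) (Y ^ j * p) + Y ^ Suc j * D p"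
  by (induction j) (simp_all add: D_Y_times mult.assoc ring_distribs scale_xy_simps scale_xy_mult_right)

text \<open>The extension to j = 0 and r = 0 lets one sum over j \<le> r cover the identity
  \<open>G 0\<close> too, and keeps predecessors out of the recurrence.\<close>

definition G_coeff :: "nat \<Rightarrow> nat \<Rightarrow> rat" where
  "G_coeff r j = (if r = 0 then (if j = 0 then 1 else 0)
     else if j = 0 then 0 else of_nat ((r - 1) choose (j - 1)) / fact j)"

lemma G_eq_sum: "G r p = (\<Sum>j\<le>r. scale_xy (G_coeff r j) (Y ^ r * X ^ j * (D ^^ j) p))"
proof (cases "r = 0")
  case False
  have "(\<Sum>j\<le>r. scale_xy (G_coeff r j) (Y ^ r * X ^ j * (D ^^ j) p))
      = (\<Sum>j=1..r. scale_xy (G_coeff r j) (Y ^ r * X ^ j * (D ^^ j) p))"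
    by (rule sum.mono_neutral_right) (use False in \<open>auto simp: G_coeff_def scale_xy_simps\<close>)
  then show ?thesis using False
    by (simp add: G_def G_coeff_def sum_distrib_left scale_xy_mult_right mult.assoc)
qed (simp add: G_def G_coeff_def scale_xy_simps)

text \<open>With s = r - 1 and i = j - 1, clearing (j + 1)! and applying Pascal's rule leaves the
  absorption identity (i + 1) C(s, i + 1) = (s - i) C(s, i).\<close>

lemma G_coeff_Suc_Suc:
  "of_nat (Suc r) * G_coeff (Suc r) (Suc j) = of_nat (r + Suc j) * G_coeff r (Suc j) + G_coeff r j"
proof (cases "r = 0 \<or> j = 0")
  case True
  then show ?thesis by (cases "j = 0") (auto simp: G_coeff_def)
next
  case False
  then obtain s i where r: "r = Suc s" and j: "j = Suc i" by (metis not0_implies_Suc)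
  have "Suc i * (s choose Suc i) = (s - i) * (s choose i)"
    using binomial_absorb_comp[of s i] binomial_absorption[of i s] times_binomial_minus1_eq
    by (metis Suc_times_binomial_add add_diff_inverse_nat binomial_eq_0 linorder_not_le mult_0_right not_less_eq)
  then have "of_nat (Suc i * (s choose Suc i)) = (of_nat ((s - i) * (s choose i)) :: rat)"
    by (simp only:)
  then have "of_nat (Suc i) * of_nat (s choose Suc i) = (of_nat s - of_nat i) * (of_nat (s choose i) :: rat)"
    unfolding of_nat_mult by (cases "i \<le> s") (auto simp: binomial_eq_0 of_nat_diff)
  then have "of_nat (Suc r) * of_nat (r choose j)
      = of_nat (r + Suc j) * of_nat (s choose j) + of_nat (Suc j) * (of_nat (s choose i) :: rat)"
    by (simp add: r j algebra_simps)
  moreover have "of_nat (s choose i) / fact j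
      = of_nat (Suc j) * of_nat (s choose i) / (fact (Suc j) :: rat)"
    by (simp add: divide_simps del: of_nat_Suc)
  ultimately show ?thesis
    by (simp add: G_coeff_def r j add_divide_distrib[symmetric] del: fact_Suc of_nat_Suc)
qed

text \<open>In the coordinates \<open>u = x / y\<close> and \<open>d = y - x\<close> this reads
  \<open>(r + 1) G\<^sub>r\<^sub>+\<^sub>1 = d (u \<partial>\<^sub>u + r) G\<^sub>r\<close>.\<close>

lemma G_Suc:
  "scale_xy (of_nat (Suc r)) (G (Suc r) p) = X * Y * D (G r p) + scale_xy (of_nat r) ((Y - X) * G r p)"
proof -
  define m where "m = (\<lambda>j. Y ^ Suc r * X ^ j * (D ^^ j) p)"
  \<comment> \<open>Differentiating \<open>Y ^ r\<close> produces r terms carrying a surplus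
    \<open>X\<close> instead of a \<open>Y\<close>; the correction r (\<open>Y\<close> -
    \<open>X\<close>) trades exactly these for multiples of \<open>m j\<close>.\<close>
  have step: "X * Y * D (Y ^ r * X ^ j * (D ^^ j) p)
      + scale_xy (of_nat r) ((Y - X) * (Y ^ r * X ^ j * (D ^^ j) p))
      = scale_xy (of_nat (r + j)) (m j) + m (Suc j)" for j
  proof -
    have "X * Y * D (Y ^ r * X ^ j * (D ^^ j) p)
        = scale_xy (of_nat r) (X * (Y ^ r * X ^ j * (D ^^ j) p)) + Y ^ Suc r * (X * D (X ^ j * (D ^^ j) p))"
      using arg_cong[OF Y_D_Y_power[of r "X ^ j * (D ^^ j) p"], of "\<lambda>q. X * q"]
      by (simp add: algebra_simps scale_xy_mult_right)
    then show ?thesis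
      unfolding X_D_X_power m_def
      by (simp add: algebra_simps scale_xy_mult_right scale_xy.scale_right_diff_distrib scale_xy_simps(2))
  qed
  have "X * Y * D (G r p) + scale_xy (of_nat r) ((Y - X) * G r p)
      = (\<Sum>j\<le>r. scale_xy (G_coeff r j) (scale_xy (of_nat (r + j)) (m j) + m (Suc j)))"
    unfolding G_eq_sum step[symmetric]
    by (simp add: D_sum D_scale_xy sum_distrib_left scale_xy.scale_sum_right sum.distrib
        scale_xy_mult_right scale_xy_simps(1,3) mult.commute)
  also have "\<dots> = (\<Sum>j\<le>r. scale_xy (of_nat (r + j) * G_coeff r j) (m j))
      + (\<Sum>j\<le>r. scale_xy (G_coeff r j) (m (Suc j)))"
    by (simp add: scale_xy_simps(1,3) sum.distrib mult.commute)
  \<comment> \<open>The new term is zero because \<open>G_coeff r (Suc r) = 0\<close>. In the shift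
    that follows, the term at j = 0 is zero as well: either r = 0 or
    \<open>G_coeff r 0 = 0\<close>.\<close>
  also have "(\<Sum>j\<le>r. scale_xy (of_nat (r + j) * G_coeff r j) (m j))
      = (\<Sum>j\<le>Suc r. scale_xy (of_nat (r + j) * G_coeff r j) (m j))"
    by (simp add: G_coeff_def)
  also have "\<dots> = (\<Sum>j\<le>r. scale_xy (of_nat (r + Suc j) * G_coeff r (Suc j)) (m (Suc j)))"
    by (subst sum.atMost_Suc_shift) (simp add: G_coeff_def)
  also have "\<dots> + (\<Sum>j\<le>r. scale_xy (G_coeff r j) (m (Suc j)))
      = (\<Sum>j\<le>r. scale_xy (of_nat (Suc r) * G_coeff (Suc r) (Suc j)) (m (Suc j)))"
    unfolding G_coeff_Suc_Suc by (simp add: scale_xy_simps(2) sum.distrib)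
  also have "\<dots> = (\<Sum>j\<le>Suc r. scale_xy (of_nat (Suc r) * G_coeff (Suc r) j) (m j))"
    unfolding sum.atMost_Suc_shift by (simp add: G_coeff_def[of _ 0])
  also have "\<dots> = scale_xy (of_nat (Suc r)) (G (Suc r) p)"
    unfolding G_eq_sum m_def by (simp only: scale_xy.scale_sum_right scale_xy_simps(3))
  finally show ?thesis ..
qed

text \<open>On the coefficient of u^k, \<open>G_Suc\<close> multiplies by d (k + r), matching
  \<open>hcount_Suc\<close>; the induction closes because r + 1 is invertible.\<close>

lemma ud_coeff_G: "ud_coeff (G r p) k = principal_spec k (complete_h r) * ud_coeff p k"
proof (induction r)
  case 0
  show ?case by (simp add: G_def principal_spec_complete_h)
next
  case (Suc r)
  have "fps_const (of_nat (Suc r)) * ud_coeff (G (Suc r) p) k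
      = ud_coeff (scale_xy (of_nat (Suc r)) (G (Suc r) p)) k" by simp
  also have "\<dots> = fps_const (of_nat ((k + r) * hcount k r)) * fps_X ^ Suc r * ud_coeff p k"
    unfolding G_Suc
    unfolding ud_coeff_add ud_coeff_scale ud_coeff_XYD ud_coeff_Y_minus_X Suc.IH principal_spec_complete_h
    by (simp add: algebra_simps flip: fps_const_mult fps_const_add del: of_nat_Suc)
  also have "\<dots> = fps_const (of_nat (Suc r)) * (principal_spec k (complete_h (Suc r)) * ud_coeff p k)"
    unfolding hcount_Suc[symmetric] principal_spec_complete_h of_nat_mult fps_const_mult[symmetric]
    by (simp only: ac_simps)
  finally have "fps_const (inverse (of_nat (Suc r))) * fps_const (of_nat (Suc r))
      * ud_coeff (G (Suc r) p) k = fps_const (inverse (of_nat (Suc r))) * fps_const (of_nat (Suc r))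
      * (principal_spec k (complete_h (Suc r)) * ud_coeff p k)"
    by (simp only: mult.assoc)
  then show ?case
    by (simp only: fps_const_mult) (simp del: of_nat_Suc)
qed

section \<open>The fundamental basis and its specialisation\<close>

text \<open>For a monomial with exponents a1, ..., ak in the order of its variables these are the
  partial sums a1, a1 + a2, ... short of the degree: an encoding of the exponent composition that
  forgets the variables.\<close>

definition descents :: "nat multiset \<Rightarrow> nat set" where
  "descents M = {j. 1 \<le> j \<and> j < size M \<and>
     sorted_list_of_multiset M ! (j - 1) < sorted_list_of_multiset M ! j}"

lemma sorted_list_of_multiset_eqI: "sorted l \<Longrightarrow> mset l = M \<Longrightarrow> sorted_list_of_multiset M = l"
  by (auto simp: sort_key_id_if_sorted)

lemma descents_mset:
  "sorted l \<Longrightarrow> descents (mset l) = {j. 1 \<le> j \<and> j < length l \<and> l ! (j - 1) < l ! j}"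
  by (simp add: descents_def sort_key_id_if_sorted)

text \<open>A monomial has a single weakly increasing arrangement, so the count is 0 or 1.\<close>

lemma mcoeff_fundamental:
  assumes "S \<subseteq> {1..<N}"
  shows "mcoeff (fundamental N S) M = (if size M = N \<and> S \<subseteq> descents M then 1 else 0)"
proof -
  define L where "L = sorted_list_of_multiset M"
  have L: "sorted l \<and> mset l = M \<longleftrightarrow> l = L" for l
    unfolding L_def
    by (metis sorted_list_of_multiset_eqI mset_sorted_list_of_multiset sorted_sorted_list_of_multiset)
  have len: "length L = size M" unfolding L_def by (metis mset_sorted_list_of_multiset size_mset)
  have "(\<forall>j\<in>S. L ! (j - 1) < L ! j) \<longleftrightarrow> S \<subseteq> descents M" if "size M = N"
    using assms that by (auto simp: descents_def L_def subset_iff)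
  then have "(if size M = N \<and> S \<subseteq> descents M then {L} else {})
      = {l. l = L \<and> length L = N \<and> (\<forall>j\<in>S. L ! (j - 1) < L ! j)}"
    using len by auto
  also have "\<dots> = {l. length l = N \<and> sorted l \<and> (\<forall>j\<in>S. l ! (j - 1) < l ! j) \<and> mset l = M}"
  proof (rule Collect_cong)
    fix l
    show "l = L \<and> length L = N \<and> (\<forall>j\<in>S. L ! (j - 1) < L ! j) \<longleftrightarrow>
        length l = N \<and> sorted l \<and> (\<forall>j\<in>S. l ! (j - 1) < l ! j) \<and> mset l = M"
      using L[of l] by (cases "l = L") simp_all
  qed
  finally have "{l. length l = N \<and> sorted l \<and> (\<forall>j\<in>S. l ! (j - 1) < l ! j) \<and> mset l = M}
      = (if size M = N \<and> S \<subseteq> descents M then {L} else {})" ..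
  then show ?thesis by (simp add: fundamental.rep_eq)
qed

lemma homogeneous_fundamental: "S \<subseteq> {1..<N} \<Longrightarrow> homogeneous N (fundamental N S)"
  by (auto simp: homogeneous_def mcoeff_fundamental split: if_splits)

text \<open>A strict increase is always visible at some adjacent step, so the descent set alone
  decides which positions hold equal entries.\<close>

lemma sorted_nth_less_iff:
  fixes l :: "nat list"
  assumes "sorted l" "i < length l" "j < length l"
  shows "l ! i < l ! j \<longleftrightarrow> (\<exists>k. i < k \<and> k \<le> j \<and> l ! (k - 1) < l ! k)"
proof
  assume less: "l ! i < l ! j"
  show "\<exists>k. i < k \<and> k \<le> j \<and> l ! (k - 1) < l ! k"
  proof (rule ccontr)
    assume no: "\<not> ?thesis"
    have "i \<le> j" using less assms by (metis leI less_le_not_le nat_le_linear sorted_nth_mono)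
    then have "l ! j \<le> l ! i" using no
    proof (induction j rule: dec_induct)
      case (step m)
      then have "l ! m \<le> l ! i" by (meson le_SucI)
      moreover have "l ! Suc m \<le> l ! m" using step by (metis diff_Suc_1 le_refl less_Suc_eq_le not_le)
      ultimately show ?case by simp
    qed simp
    with less show False by simp
  qed
next
  assume "\<exists>k. i < k \<and> k \<le> j \<and> l ! (k - 1) < l ! k"
  then obtain k where k: "i < k" "k \<le> j" "l ! (k - 1) < l ! k" by blast
  have "l ! i \<le> l ! (k - 1)" "l ! k \<le> l ! j"
    using k assms by (auto intro!: sorted_nth_mono)
  with k(3) show "l ! i < l ! j" by simp
qed

text \<open>Matching the two sorted words position by position is well defined and strictly
  increasing, because equal descents mean equal ties. The matching is therefore a relabelling that
  quasisymmetry permits.\<close>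

lemma mcoeff_eq_if_descents_eq:
  assumes "quasisymmetric f" "size M = size M'" "descents M = descents M'"
  shows "mcoeff f M = mcoeff f M'"
proof -
  define l where "l = sorted_list_of_multiset M"
  define l' where "l' = sorted_list_of_multiset M'"
  have sorted: "sorted l" "sorted l'" and mset: "mset l = M" "mset l' = M'"
    by (auto simp: l_def l'_def)
  have len: "length l' = length l" using mset assms(2) by (metis size_mset)
  have less: "l ! i < l ! j \<longleftrightarrow> l' ! i < l' ! j" if "i < length l" "j < length l" for i j
  proof -
    have "l ! (k - 1) < l ! k \<longleftrightarrow> l' ! (k - 1) < l' ! k" if "1 \<le> k" "k < length l" for k
      using assms(3) that len sorted unfolding mset[symmetric] by (auto simp: descents_mset set_eq_iff)
    then have "(i < k \<and> k \<le> j \<and> l ! (k - 1) < l ! k) \<longleftrightarrow> (i < k \<and> k \<le> j \<and> l' ! (k - 1) < l' ! k)" for k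
      using that by (cases "1 \<le> k \<and> k < length l") auto
    then show ?thesis
      using that len sorted by (simp only: sorted_nth_less_iff)
  qed
  define \<phi> where "\<phi> x = l' ! (SOME i. i < length l \<and> l ! i = x)" for x
  have \<phi>: "\<phi> (l ! i) = l' ! i" if "i < length l" for i
  proof -
    define m where "m = (SOME m. m < length l \<and> l ! m = l ! i)"
    have m: "m < length l" "l ! m = l ! i"
      using someI[of "\<lambda>m. m < length l \<and> l ! m = l ! i" i] that by (auto simp: m_def)
    then have "l' ! m = l' ! i" using less[OF m(1) that] less[OF that m(1)] m(2) by simp
    then show ?thesis by (simp add: \<phi>_def m_def)
  qed
  have "strict_mono_on (set_mset M) \<phi>"
    unfolding mset(1)[symmetric]
    by (rule strict_mono_onI) (auto simp: in_set_conv_nth \<phi> less)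
  moreover have "image_mset \<phi> M = M'"
  proof -
    have "map \<phi> l = l'" by (rule nth_equalityI) (auto simp: len \<phi>)
    then show ?thesis using mset by (metis mset_map)
  qed
  ultimately show ?thesis using assms(1) by (auto simp: quasisymmetric_def)
qed

lemma ex_descents:
  assumes "T \<subseteq> {1..<N}"
  shows "\<exists>M. size M = N \<and> descents M = T"
proof -
  \<comment> \<open>The entry at position j, counted from 0, is the number of elements of
    \<open>T\<close> up to j; it rises exactly when j belongs to \<open>T\<close>.\<close>
  define l where "l = map (\<lambda>j. card (T \<inter> {1..j})) [0..<N]"
  have sorted: "sorted l"
    unfolding l_def sorted_map by (rule sorted_wrt_mono_rel[of _ "(\<le>)"]) (auto intro: card_mono)
  have "l ! (j - 1) < l ! j \<longleftrightarrow> j \<in> T" if j: "1 \<le> j" "j < N" for j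
  proof -
    have "{1..j} = insert j {1..j - 1}" using j by auto
    then show ?thesis using j by (simp add: l_def Int_insert_right)
  qed
  moreover have "length l = N" by (simp add: l_def)
  ultimately have "descents (mset l) = T"
    using assms unfolding descents_mset[OF sorted] by auto
  then show ?thesis by (intro exI[of _ "mset l"]) (simp add: l_def)
qed

text \<open>Justifies the \<open>THE\<close> in \<open>fundamental_coeffs\<close>. At monomials with
  descent set T the family yields the inclusion matrix S \<subseteq> T, which is triangular for
  minus the cardinality.\<close>

lemma fundamental_expansion:
  assumes f: "f \<in> QSym N"
  shows "(\<forall>S. \<not> S \<subseteq> {1..<N} \<longrightarrow> fundamental_coeffs N f S = 0) \<and>
    f = (\<Sum>S\<in>Pow {1..<N}. mscale (fundamental_coeffs N f S) (fundamental N S))"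
proof -
  let ?P = "Pow {1..<N}" and ?A = "\<lambda>S T. if S \<subseteq> T then 1 else 0 :: rat"
  let ?w = "\<lambda>S. - int (card S)"
  obtain m where m: "\<And>T. T \<subseteq> {1..<N} \<Longrightarrow> size (m T) = N \<and> descents (m T) = T"
    using choice[of "\<lambda>T M. T \<subseteq> {1..<N} \<longrightarrow> size M = N \<and> descents M = T"] ex_descents by blast
  have fin: "finite ?P" by simp
  have diag: "?A S S \<noteq> 0" if "S \<in> ?P" for S by simp
  have tri: "T = S \<or> ?w T < ?w S" if "S \<in> ?P" "T \<in> ?P" "?A S T \<noteq> 0" for S T
    using that psubset_card_mono[of T S] finite_subset[of T "{1..<N}"] by (auto split: if_splits)
  have coeff: "mcoeff (\<Sum>S\<in>?P. mscale (c S) (fundamental N S)) M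
      = (if size M = N then \<Sum>S\<in>?P. c S * ?A S (descents M) else 0)" for c M
    by (auto simp: mcoeff_sum mcoeff_fundamental intro!: sum.cong)
  have "\<exists>c. \<forall>T\<in>?P. (\<Sum>S\<in>?P. c S * ?A S T) = mcoeff f (m T)"
    by (rule triangular_solve[where w = ?w, OF fin]) (fact diag, fact tri)
  then obtain c where c: "\<And>T. T \<in> ?P \<Longrightarrow> (\<Sum>S\<in>?P. c S * ?A S T) = mcoeff f (m T)"
    by blast
  define c' where "c' S = (if S \<in> ?P then c S else 0)" for S
  have "f = (\<Sum>S\<in>?P. mscale (c' S) (fundamental N S))"
  proof (rule mseries_eqI)
    fix M
    show "mcoeff f M = mcoeff (\<Sum>S\<in>?P. mscale (c' S) (fundamental N S)) M"
    proof (cases "size M = N")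
      case True
      have D: "descents M \<in> ?P" using True by (auto simp: descents_def)
      have "mcoeff f M = mcoeff f (m (descents M))"
        using f m[of "descents M"] D True by (intro mcoeff_eq_if_descents_eq) (auto simp: QSym_def)
      also have "\<dots> = (\<Sum>S\<in>?P. c' S * ?A S (descents M))"
        unfolding c[OF D, symmetric] by (rule sum.cong) (auto simp: c'_def)
      finally show ?thesis using True coeff[of c' M] by simp
    next
      case False
      then show ?thesis using f coeff[of c' M] by (auto simp: QSym_def homogeneous_def)
    qed
  qed
  moreover have "c' S = 0" if "\<not> S \<subseteq> {1..<N}" for S using that by (simp add: c'_def)
  moreover have "d = c'" if d: "\<forall>S. \<not> S \<subseteq> {1..<N} \<longrightarrow> d S = 0"
      "f = (\<Sum>S\<in>?P. mscale (d S) (fundamental N S))" for d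
  proof (rule ext)
    fix S
    have sum0: "(\<Sum>S\<in>?P. (d S - c' S) * ?A S T) = 0" if T: "T \<in> ?P" for T
    proof -
      have "mcoeff (\<Sum>S\<in>?P. mscale (d S) (fundamental N S)) (m T)
          = mcoeff (\<Sum>S\<in>?P. mscale (c' S) (fundamental N S)) (m T)"
        using d(2) \<open>f = (\<Sum>S\<in>?P. mscale (c' S) (fundamental N S))\<close> by simp
      then have "(\<Sum>S\<in>?P. d S * ?A S T) = (\<Sum>S\<in>?P. c' S * ?A S T)"
        unfolding coeff using m[of T] T by simp
      then show ?thesis
        by (simp only: left_diff_distrib sum_subtractf diff_self)
    qed
    have "d S - c' S = 0" if "S \<in> ?P"
      using triangular_kernel[where w = ?w and c = "\<lambda>S. d S - c' S" and A = ?A and i = S and P = ?P]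
        fin diag tri sum0 that by blast
    then show "d S = c' S" using d(1) by (cases "S \<in> ?P") (auto simp: c'_def)
  qed
  ultimately have "\<exists>!c. (\<forall>S. \<not> S \<subseteq> {1..<N} \<longrightarrow> c S = 0) \<and>
      f = (\<Sum>S\<in>?P. mscale (c S) (fundamental N S))"
    by (intro ex1I[of _ c']) auto
  from theI'[OF this] show ?thesis unfolding fundamental_coeffs_def .
qed

section \<open>Values of the fundamental functions at k ones and their generating function\<close>

definition bounded_seqs :: "nat \<Rightarrow> nat set \<Rightarrow> nat \<Rightarrow> nat list set" where
  "bounded_seqs N S k = {l. length l = N \<and> sorted l \<and> (\<forall>j\<in>S. l ! (j - 1) < l ! j) \<and> set l \<subseteq> {..<k}}"

lemma finite_bounded_seqs [simp]: "finite (bounded_seqs N S k)"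
proof (rule finite_subset)
  show "bounded_seqs N S k \<subseteq> {l. set l \<subseteq> {..<k} \<and> length l = N}" by (auto simp: bounded_seqs_def)
qed (simp add: finite_lists_length_eq)

lemma bounded_seqs_0: "bounded_seqs 0 {} k = {[]}"
  by (auto simp: bounded_seqs_def)

lemma bounded_seqs_bound_0: "N > 0 \<Longrightarrow> bounded_seqs N S 0 = {}"
  by (auto simp: bounded_seqs_def)

text \<open>The last entry is the maximum. Either it is below k, or it equals k and is removed; in
  the latter case a strict step at \<open>N\<close> forces the remaining entries below k.\<close>

lemma card_bounded_seqs_Suc:
  assumes S: "S \<subseteq> {1..<Suc N}"
  shows "card (bounded_seqs (Suc N) S (Suc k)) = card (bounded_seqs (Suc N) S k) +
    (if N \<in> S then card (bounded_seqs N (S - {N}) k) else card (bounded_seqs N S (Suc k)))"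
proof -
  define Q where "Q = (if N \<in> S then bounded_seqs N (S - {N}) k else bounded_seqs N S (Suc k))"
  have nth': "(l @ [v]) ! (j - 1) < (l @ [v]) ! j \<longleftrightarrow>
      (if j = N then l ! (N - 1) < v else l ! (j - 1) < l ! j)"
    if "length l = N" "j \<in> S" for l v j
    using S that by (auto simp: nth_append)
  have nth: "(\<forall>j\<in>S. (l @ [v]) ! (j - 1) < (l @ [v]) ! j) \<longleftrightarrow>
      (\<forall>j\<in>S - {N}. l ! (j - 1) < l ! j) \<and> (N \<in> S \<longrightarrow> l ! (N - 1) < v)"
    if "length l = N" for l v
    using nth'[OF that] by auto
  have last_less: "l ! (N - 1) < v \<longleftrightarrow> set l \<subseteq> {..<v}"
    if "sorted l" "length l = N" "N \<in> S" for l :: "nat list" and v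
  proof
    assume *: "l ! (N - 1) < v"
    have "l ! i \<le> l ! (N - 1)" if "i < N" for i
      using that \<open>sorted l\<close> \<open>length l = N\<close> by (intro sorted_nth_mono) auto
    with * show "set l \<subseteq> {..<v}" using \<open>length l = N\<close> by (fastforce simp: in_set_conv_nth)
  next
    assume "set l \<subseteq> {..<v}"
    moreover have "l ! (N - 1) \<in> set l" using that S by (intro nth_mem) auto
    ultimately show "l ! (N - 1) < v" by auto
  qed
  have snoc_iff: "l @ [v] \<in> bounded_seqs (Suc N) S (Suc k) \<longleftrightarrow>
      l @ [v] \<in> bounded_seqs (Suc N) S k \<or> v = k \<and> l \<in> Q" if len: "length l = N" for l v
  proof (cases "sorted l")
    case True
    have "l @ [v] \<in> bounded_seqs (Suc N) S k' \<longleftrightarrow> v < k' \<and> set l \<subseteq> {..v} \<and>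
        (\<forall>j\<in>S - {N}. l ! (j - 1) < l ! j) \<and> (N \<in> S \<longrightarrow> set l \<subseteq> {..<v})" for k'
      using True len last_less[of l v] nth[of l v]
      by (auto simp: bounded_seqs_def sorted_append subset_iff)
    moreover have "l \<in> Q \<longleftrightarrow> set l \<subseteq> {..k} \<and> (\<forall>j\<in>S - {N}. l ! (j - 1) < l ! j) \<and>
        (N \<in> S \<longrightarrow> set l \<subseteq> {..<k})"
      using True len by (auto simp: Q_def bounded_seqs_def)
    ultimately show ?thesis by (auto simp: less_Suc_eq)
  next
    case False
    then show ?thesis by (auto simp: Q_def bounded_seqs_def sorted_append)
  qed
  have "bounded_seqs (Suc N) S (Suc k) = bounded_seqs (Suc N) S k \<union> (\<lambda>l. l @ [k]) ` Q"
  proof (rule set_eqI)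
    fix l :: "nat list"
    show "l \<in> bounded_seqs (Suc N) S (Suc k) \<longleftrightarrow> l \<in> bounded_seqs (Suc N) S k \<union> (\<lambda>l. l @ [k]) ` Q"
    proof (cases l rule: rev_cases)
      case (snoc l' v)
      show ?thesis
      proof (cases "length l' = N")
        case True
        then show ?thesis using snoc by (auto simp: snoc_iff)
      next
        case False
        then show ?thesis using snoc by (auto simp: bounded_seqs_def Q_def)
      qed
    qed (auto simp: bounded_seqs_def)
  qed
  moreover have "bounded_seqs (Suc N) S k \<inter> (\<lambda>l. l @ [k]) ` Q = {}"
    by (auto simp: bounded_seqs_def)
  moreover have "finite Q" by (simp add: Q_def)
  ultimately have "card (bounded_seqs (Suc N) S (Suc k)) = card (bounded_seqs (Suc N) S k) + card Q"
    by (simp add: card_Un_disjoint card_image inj_on_def)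
  then show ?thesis by (simp add: Q_def)
qed

text \<open>The convention at \<open>N = k = 0\<close> matches \<open>\<Phi>\<^sub>0(1) = x\<close>.\<close>

definition seq_gf :: "nat \<Rightarrow> nat set \<Rightarrow> rat fps" where
  "seq_gf N S = Abs_fps (\<lambda>k. if N = 0 \<and> k = 0 then 0 else of_nat (card (bounded_seqs N S k)))"

text \<open>Multiplication by 1 - u takes differences in k, which
  \<open>card_bounded_seqs_Suc\<close> evaluates: each further letter costs a factor 1 / (1 - u),
  each element of \<open>S\<close> a factor u.\<close>

lemma seq_gf: "S \<subseteq> {1..<N} \<Longrightarrow> seq_gf N S = fps_X ^ (card S + 1) * geometric ^ (N + 1)"
proof (induction N arbitrary: S)
  case 0
  then have "S = {}" by simp
  have "(1 - fps_X) * seq_gf 0 {} = fps_X"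
    by (rule fps_ext) (auto simp: seq_gf_def bounded_seqs_0 left_diff_distrib fps_X_mult_nth fps_X_nth)
  then have "fps_X * geometric = ((1 - fps_X) * geometric) * seq_gf 0 {}" by (metis mult.assoc mult.commute)
  then show ?case using \<open>S = {}\<close> by (simp add: geometric_times)
next
  case (Suc N)
  have "seq_gf (Suc N) S - fps_X * seq_gf (Suc N) S
      = (if N \<in> S then fps_X * seq_gf N (S - {N}) else seq_gf N S)" (is "?L = ?R")
  proof (rule fps_ext)
    fix k
    \<comment> \<open>With \<open>N\<close> in \<open>S\<close> the shifted series avoids the
      exceptional value at N = k = 0. Otherwise, for N = 0, that value is what makes the two sides
      agree at k = 0.\<close>
    have "N > 0" if "N \<in> S" using that Suc.prems by auto
    then show "?L $ k = ?R $ k"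
      using card_bounded_seqs_Suc[OF Suc.prems, of "k - 1"]
      by (cases k) (auto simp: seq_gf_def fps_X_mult_nth bounded_seqs_bound_0)
  qed
  also have "\<dots> = fps_X ^ (card S + 1) * geometric ^ (N + 1)"
  proof (cases "N \<in> S")
    case True
    have "finite S" using Suc.prems finite_subset by blast
    then have "card S = Suc (card (S - {N}))" using True by (metis card_Suc_Diff1)
    moreover have "seq_gf N (S - {N}) = fps_X ^ (card (S - {N}) + 1) * geometric ^ (N + 1)"
      using Suc.prems by (intro Suc.IH) (auto simp: subset_iff less_Suc_eq)
    ultimately show ?thesis using True by (simp add: mult.assoc)
  next
    case False
    then have "S \<subseteq> {1..<N}" using Suc.prems by (auto simp: subset_iff less_Suc_eq)
    then show ?thesis using Suc.IH False by simp
  qed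
  finally have "(1 - fps_X) * seq_gf (Suc N) S = fps_X ^ (card S + 1) * geometric ^ (N + 1)"
    by (simp add: left_diff_distrib)
  then have "((1 - fps_X) * geometric) * seq_gf (Suc N) S = geometric * (fps_X ^ (card S + 1) * geometric ^ (N + 1))"
    by (metis mult.assoc mult.commute)
  then show ?case unfolding geometric_times by (simp add: ac_simps)
qed

lemma principal_spec_fundamental:
  assumes "S \<subseteq> {1..<N}"
  shows "principal_spec k (fundamental N S) = fps_const (of_nat (card (bounded_seqs N S k))) * fps_X ^ N"
proof -
  have "bij_betw mset (bounded_seqs N S k) {M \<in> monomials k N. S \<subseteq> descents M}"
  proof (rule bij_betw_byWitness[where f' = sorted_list_of_multiset])
    show "mset ` bounded_seqs N S k \<subseteq> {M \<in> monomials k N. S \<subseteq> descents M}"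
      using assms by (auto simp: bounded_seqs_def monomials_def descents_mset subset_iff)
    show "sorted_list_of_multiset ` {M \<in> monomials k N. S \<subseteq> descents M} \<subseteq> bounded_seqs N S k"
      by (auto simp: bounded_seqs_def monomials_def descents_def subset_iff
          simp flip: size_mset[of "sorted_list_of_multiset _"] set_mset_mset)
  qed (auto simp: bounded_seqs_def sort_key_id_if_sorted)
  then have "card (bounded_seqs N S k) = card {M \<in> monomials k N. S \<subseteq> descents M}"
    by (rule bij_betw_same_card)
  moreover have "(\<Sum>M\<in>monomials k N. mcoeff (fundamental N S) M)
      = (\<Sum>M\<in>{M \<in> monomials k N. S \<subseteq> descents M}. 1)"
    unfolding sum.inter_filter[OF finite_monomials]
    by (rule sum.cong) (auto simp: mcoeff_fundamental[OF assms] monomials_def)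
  ultimately have "(\<Sum>M\<in>monomials k N. mcoeff (fundamental N S) M) = of_nat (card (bounded_seqs N S k))"
    by simp
  then show ?thesis by (simp add: principal_spec_homogeneous[OF homogeneous_fundamental[OF assms]])
qed

lemma ud_coeff_monomial:
  "ud_coeff (X ^ i * Y ^ j) k = fps_const ((fps_X ^ i * geometric ^ (i + j)) $ k) * fps_X ^ (i + j)"
proof (rule fps_ext)
  fix n
  have "dehomog n (X ^ i * Y ^ j) = (if n = i + j then fps_X ^ i else 0)"
    by (rule fps_ext) (auto simp: dehomog_def pcoeff_X_power_Y_power fps_X_power_nth)
  then show "ud_coeff (X ^ i * Y ^ j) k $ n
      = (fps_const ((fps_X ^ i * geometric ^ (i + j)) $ k) * fps_X ^ (i + j)) $ n"
    by (simp add: ud_coeff_def ud_slice_def)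
qed

text \<open>The factor d reflects that the image has degree N + 1. At k = 0 the image has no term
  because x divides it, whereas the specialisation of a constant is nonzero there.\<close>

lemma ud_coeff_Phi:
  assumes "f \<in> QSym N"
  shows "ud_coeff (Phi N f) k = (if k = 0 then 0 else fps_X * principal_spec k f)"
proof -
  have summand: "ud_coeff (X ^ (card S + 1) * Y ^ (N - card S)) k
      = (if k = 0 then 0 else fps_X * principal_spec k (fundamental N S))" if S: "S \<in> Pow {1..<N}" for S
  proof -
    have "card S \<le> card {1..<N}" using S by (intro card_mono) auto
    then have "card S + 1 + (N - card S) = N + 1" by simp
    then have "ud_coeff (X ^ (card S + 1) * Y ^ (N - card S)) k = fps_const (seq_gf N S $ k) * fps_X ^ (N + 1)"
      using S by (simp only: ud_coeff_monomial seq_gf Pow_iff)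
    also have "\<dots> = (if k = 0 then 0 else fps_X * principal_spec k (fundamental N S))"
      using S by (auto simp: seq_gf_def principal_spec_fundamental bounded_seqs_bound_0)
    finally show ?thesis .
  qed
  have "ud_coeff (Phi N f) k = (\<Sum>S\<in>Pow {1..<N}. fps_const (fundamental_coeffs N f S) *
      (if k = 0 then 0 else fps_X * principal_spec k (fundamental N S)))"
    unfolding Phi_def ud_coeff_sum ud_coeff_scale by (intro sum.cong refl) (simp only: summand)
  also have "\<dots> = (if k = 0 then 0 else fps_X * principal_spec k
      (\<Sum>S\<in>Pow {1..<N}. mscale (fundamental_coeffs N f S) (fundamental N S)))"
    by (simp add: principal_spec_sum sum_distrib_left mult.left_commute)
  finally show ?thesis using fundamental_expansion[OF assms] by simp
qed

section \<open>Generation by complete homogeneous functions\<close>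

definition weighted_mset :: "nat list \<Rightarrow> 'a list \<Rightarrow> 'a multiset" where
  "weighted_mset la xs = sum_list (map2 replicate_mset la xs)"

abbreviation partition_mset :: "nat list \<Rightarrow> nat multiset" where
  "partition_mset la \<equiv> weighted_mset la [0..<length la]"

lemma weighted_mset_simps [simp]:
  "weighted_mset [] xs = {#}"
  "weighted_mset (a # la) (x # xs) = replicate_mset a x + weighted_mset la xs"
  by (simp_all add: weighted_mset_def)

lemma image_weighted_mset:
  "length la = length xs \<Longrightarrow> image_mset \<phi> (weighted_mset la xs) = weighted_mset la (map \<phi> xs)"
  by (induction la xs rule: list_induct2) auto

lemma size_weighted_mset: "length la = length xs \<Longrightarrow> size (weighted_mset la xs) = sum_list la"
  by (induction la xs rule: list_induct2) auto

lemma set_weighted_mset: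
  "length la = length xs \<Longrightarrow> 0 \<notin> set la \<Longrightarrow> set_mset (weighted_mset la xs) = set xs"
  by (induction la xs rule: list_induct2) auto

lemma set_weighted_mset_subset:
  "length la = length xs \<Longrightarrow> set_mset (weighted_mset la xs) \<subseteq> set xs"
  by (induction la xs rule: list_induct2) (auto split: if_splits)

lemma map_count_weighted_mset:
  assumes "length la = length xs" "distinct xs"
  shows "map (count (weighted_mset la xs)) xs = la"
  using assms
proof (induction la xs rule: list_induct2)
  case (Cons a la x xs)
  then have "x \<notin># weighted_mset la xs" using set_weighted_mset_subset[of la xs] by auto
  then have "count (weighted_mset (a # la) (x # xs)) x = a" by (simp add: count_eq_zero_iff)
  moreover have "map (count (weighted_mset (a # la) (x # xs))) xs = map (count (weighted_mset la xs)) xs"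
    using Cons.prems by auto
  moreover have "map (count (weighted_mset la xs)) xs = la"
    using Cons by simp
  ultimately show ?case by (simp only: list.map)
qed simp

lemma weighted_mset_map_count:
  assumes "distinct xs"
  shows "count (weighted_mset (map c xs) xs) y = (if y \<in> set xs then c y else 0)"
  using assms by (induction xs) auto

lemma ex_weighted_mset:
  fixes M :: "nat multiset"
  shows "\<exists>la xs. is_partition la \<and> distinct xs \<and> length la = length xs \<and> M = weighted_mset la xs"
proof (intro exI conjI)
  \<comment> \<open>Variables in order of decreasing exponent, so that the exponents form a
    partition.\<close>
  define xs where "xs = rev (sort_key (count M) (sorted_list_of_set (set_mset M)))"
  have set: "set xs = set_mset M" by (simp add: xs_def)
  show dist: "distinct xs" by (simp add: xs_def)
  have "sorted_wrt (\<ge>) (map (count M) xs)"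
    unfolding xs_def rev_map[symmetric] sorted_wrt_rev by simp
  moreover have "0 \<notin> set (map (count M) xs)"
    using set by (auto simp: image_iff)
  ultimately show "is_partition (map (count M) xs)"
    by (simp add: is_partition_def)
  show "M = weighted_mset (map (count M) xs) xs"
    by (rule multiset_eqI) (auto simp: weighted_mset_map_count[OF dist] set count_eq_zero_iff)
qed simp

text \<open>Every monomial is an injective relabelling of the monomial of a partition, so one
  coefficient per partition determines a symmetric function.\<close>

lemma Sym_deg_eqI:
  assumes "f \<in> Sym_deg n" "g \<in> Sym_deg n"
    and eq: "\<And>mu. mu \<in> partitions_of n \<Longrightarrow> mcoeff f (partition_mset mu) = mcoeff g (partition_mset mu)"
  shows "f = g"
proof (rule mseries_eqI)
  fix M
  show "mcoeff f M = mcoeff g M"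
  proof (cases "size M = n")
    case True
    obtain mu xs where mu: "is_partition mu" "distinct xs" "length mu = length xs" "M = weighted_mset mu xs"
      using ex_weighted_mset by blast
    have "mu \<in> partitions_of n" using mu True by (simp add: partitions_of_def size_weighted_mset)
    moreover have "M = image_mset ((!) xs) (partition_mset mu)"
      using mu by (simp add: image_weighted_mset map_nth)
    moreover have "inj_on ((!) xs) (set_mset (partition_mset mu))"
      using mu by (simp add: set_weighted_mset is_partition_def inj_on_nth)
    ultimately show ?thesis
      using assms by (simp only: mcoeff_Sym_image Sym_deg_imp_Sym eq)
  next
    case False
    then have "mcoeff f M = 0" "mcoeff g M = 0"
      using assms(1,2) by (auto simp: Sym_deg_def homogeneous_def)
    then show ?thesis by simp
  qed
qed

lemma finite_partitions_of [simp]: "finite (partitions_of n)"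
proof (rule finite_subset)
  show "partitions_of n \<subseteq> {la. set la \<subseteq> {..n} \<and> length la \<le> n}"
  proof
    fix la assume la: "la \<in> partitions_of n"
    then have "0 \<notin> set la" by (simp add: partitions_of_def is_partition_def)
    then have "length la \<le> sum_list la" by (induction la) (auto simp: Suc_le_eq)
    then show "la \<in> {la. set la \<subseteq> {..n} \<and> length la \<le> n}"
      using la by (auto simp: partitions_of_def intro: member_le_sum_list)
  qed
qed (simp add: finite_lists_length_le)

lemma Sym_deg_mscale: "f \<in> Sym_deg n \<Longrightarrow> mscale c f \<in> Sym_deg n"
  by (auto simp: Sym_deg_def homogeneous_def)

lemma Sym_deg_add: "f \<in> Sym_deg n \<Longrightarrow> g \<in> Sym_deg n \<Longrightarrow> f + g \<in> Sym_deg n"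
  unfolding Sym_deg_def homogeneous_def by (auto, metis add.right_neutral)

lemma Sym_deg_times: "f \<in> Sym_deg m \<Longrightarrow> g \<in> Sym_deg n \<Longrightarrow> f * g \<in> Sym_deg (m + n)"
  by (auto simp: Sym_deg_def homogeneous_times)

lemma Sym_deg_sum: "(\<And>x. x \<in> A \<Longrightarrow> f x \<in> Sym_deg n) \<Longrightarrow> (\<Sum>x\<in>A. f x) \<in> Sym_deg n"
proof (induction A rule: infinite_finite_induct)
  case (insert x A)
  then show ?case by (simp add: Sym_deg_add)
qed (auto simp: Sym_deg_def homogeneous_def)

text \<open>By \<open>Sym_deg_eqI\<close> only the square matrix of coefficients at partition
  monomials matters. The weight stays open because power sum products and Schur functions are
  triangular for different statistics.\<close>

lemma triangular_family_spans:
  fixes w :: "nat list \<Rightarrow> int"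
  assumes b: "\<And>la. la \<in> partitions_of n \<Longrightarrow> b la \<in> Sym_deg n"
    and diag: "\<And>la. la \<in> partitions_of n \<Longrightarrow> mcoeff (b la) (partition_mset la) \<noteq> 0"
    and tri: "\<And>la mu. la \<in> partitions_of n \<Longrightarrow> mu \<in> partitions_of n \<Longrightarrow>
      mcoeff (b la) (partition_mset mu) \<noteq> 0 \<Longrightarrow> mu = la \<or> w mu < w la"
    and f: "f \<in> Sym_deg n"
  shows "\<exists>c. f = (\<Sum>la\<in>partitions_of n. mscale (c la) (b la))"
proof -
  have "\<exists>c. \<forall>mu\<in>partitions_of n.
      (\<Sum>la\<in>partitions_of n. c la * mcoeff (b la) (partition_mset mu)) = mcoeff f (partition_mset mu)"
    by (rule triangular_solve[where w = w]) (use diag tri in auto)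
  then obtain c where "\<forall>mu\<in>partitions_of n.
      (\<Sum>la\<in>partitions_of n. c la * mcoeff (b la) (partition_mset mu)) = mcoeff f (partition_mset mu)" ..
  then have "f = (\<Sum>la\<in>partitions_of n. mscale (c la) (b la))"
    by (intro Sym_deg_eqI[OF f] Sym_deg_sum Sym_deg_mscale b) (auto simp: mcoeff_sum)
  then show ?thesis by (rule exI[of _ c])
qed

lemma triangular_family_unique:
  fixes w :: "nat list \<Rightarrow> int"
  assumes diag: "\<And>la. la \<in> partitions_of n \<Longrightarrow> mcoeff (b la) (partition_mset la) \<noteq> 0"
    and tri: "\<And>la mu. la \<in> partitions_of n \<Longrightarrow> mu \<in> partitions_of n \<Longrightarrow>
      mcoeff (b la) (partition_mset mu) \<noteq> 0 \<Longrightarrow> mu = la \<or> w mu < w la"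
    and eq: "(\<Sum>la\<in>partitions_of n. mscale (c la) (b la)) = (\<Sum>la\<in>partitions_of n. mscale (d la) (b la))"
    and la: "la \<in> partitions_of n"
  shows "c la = d la"
proof -
  have "(\<Sum>la\<in>partitions_of n. (c la - d la) * mcoeff (b la) (partition_mset mu)) = 0" for mu
    using arg_cong[OF eq, of "\<lambda>f. mcoeff f (partition_mset mu)"]
    by (simp add: mcoeff_sum left_diff_distrib sum_subtractf)
  then have "c la - d la = 0"
    using triangular_kernel[where w = w and P = "partitions_of n" and i = la and c = "\<lambda>la. c la - d la"
        and A = "\<lambda>la mu. mcoeff (b la) (partition_mset mu)"] diag tri la
    by simp
  then show ?thesis by simp
qed

section \<open>Triangularity of the power sum products\<close>

definition power_sum_prod :: "nat list \<Rightarrow> mseries" where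
  "power_sum_prod la = prod_list (map power_sum la)"

lemma power_sum_prod_Sym_deg: "power_sum_prod la \<in> Sym_deg (sum_list la)"
proof (induction la)
  case Nil
  show ?case by (auto simp: power_sum_prod_def Sym_deg_def homogeneous_def)
next
  case (Cons a la)
  have "power_sum a \<in> Sym_deg a" by (simp add: Sym_deg_def homogeneous_power_sum)
  then show ?case using Cons by (auto simp: power_sum_prod_def intro: Sym_deg_times)
qed

lemma power_sum_prod_nonneg: "mcoeff (power_sum_prod la) M \<ge> 0"
proof (induction la arbitrary: M)
  case (Cons a la)
  then show ?case by (auto simp: power_sum_prod_def mcoeff_times intro!: sum_nonneg)
qed (simp add: power_sum_prod_def)

text \<open>Each factor chooses one variable; \<open>xs\<close> records the choices, and a repeated
  variable merges parts.\<close>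

lemma power_sum_prod_support:
  "mcoeff (power_sum_prod la) M \<noteq> 0 \<Longrightarrow> \<exists>xs. length la = length xs \<and> M = weighted_mset la xs"
proof (induction la arbitrary: M)
  case (Cons a la)
  then have "mcoeff (power_sum a * power_sum_prod la) M \<noteq> 0" by (simp add: power_sum_prod_def)
  then obtain A B where AB: "M = A + B" "mcoeff (power_sum a) A \<noteq> 0" "mcoeff (power_sum_prod la) B \<noteq> 0"
    by (rule mcoeff_times_nonzeroE)
  obtain x where "A = replicate_mset a x" using AB(2) by (auto split: if_splits)
  moreover obtain xs where "length la = length xs" "B = weighted_mset la xs" using Cons.IH AB(3) by blast
  ultimately show ?case using AB(1) by (intro exI[of _ "x # xs"]) simp
qed (simp add: power_sum_prod_def split: if_splits)

text \<open>One split already contributes a positive product and nothing cancels it, so the exact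
  coefficient is never computed.\<close>

lemma power_sum_prod_pos:
  "length la = length xs \<Longrightarrow> mcoeff (power_sum_prod la) (weighted_mset la xs) > 0"
proof (induction la xs rule: list_induct2)
  case (Cons a la x xs)
  let ?p = "(replicate_mset a x, weighted_mset la xs)"
  have "0 < (case ?p of (A, B) \<Rightarrow> mcoeff (power_sum a) A * mcoeff (power_sum_prod la) B)"
    using Cons by auto
  also have "\<dots> \<le> mcoeff (power_sum a * power_sum_prod la) (weighted_mset (a # la) (x # xs))"
    unfolding mcoeff_times
  proof (rule member_le_sum)
    show "?p \<in> mset_splits (weighted_mset (a # la) (x # xs))" by (simp add: mset_splits_def)
  qed (auto simp: power_sum_prod_nonneg)
  finally show ?case by (simp add: power_sum_prod_def)
qed (simp add: power_sum_prod_def)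

lemma is_partition_mset_inject:
  assumes "is_partition la" "is_partition mu" "mset la = mset mu"
  shows "la = mu"
proof -
  have "sorted (rev la)" "sorted (rev mu)"
    using assms(1,2) by (simp_all add: is_partition_def sorted_wrt_rev)
  moreover have "mset (rev la) = mset (rev mu)" using assms(3) by simp
  ultimately have "rev la = rev mu" by (metis properties_for_sort)
  then show ?thesis by simp
qed

lemma mset_of_weighted_mset:
  assumes "length la = length xs" "distinct xs"
  shows "mset la = image_mset (count (weighted_mset la xs)) (mset xs)"
  using map_count_weighted_mset[OF assms] by (metis mset_map)

text \<open>A monomial of a product of power sums arises by merging parts, and has as many variables as
  there are factors only if nothing is merged.\<close>

lemma power_sum_prod_triangular:
  assumes "is_partition la" "is_partition mu" "mcoeff (power_sum_prod la) (partition_mset mu) \<noteq> 0"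
  shows "mu = la \<or> length mu < length la"
proof -
  obtain xs where xs: "length la = length xs" "partition_mset mu = weighted_mset la xs"
    using power_sum_prod_support[OF assms(3)] by blast
  have set: "set xs = {..<length mu}"
    using assms(1,2) xs set_weighted_mset[of la xs] set_weighted_mset[of mu "[0..<length mu]"]
    by (auto simp: is_partition_def lessThan_atLeast0)
  then have le: "length mu \<le> length la" using card_length[of xs] xs by simp
  show ?thesis
  proof (cases "length mu = length la")
    case True
    then have "distinct xs" using set xs by (simp add: card_distinct)
    then have "mset xs = mset [0..<length mu]"
      using set by (subst set_eq_iff_mset_eq_distinct[symmetric]) (auto simp: lessThan_atLeast0)
    then have "mset la = mset mu"
      using mset_of_weighted_mset[of la xs] mset_of_weighted_mset[of mu "[0..<length mu]"]
        xs \<open>distinct xs\<close> by simp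
    then show ?thesis using assms(1,2) is_partition_mset_inject by blast
  qed (use le in simp)
qed

lift_definition homogeneous_part :: "nat \<Rightarrow> mseries \<Rightarrow> mseries" is
  "\<lambda>n f M. if size M = n then f M else 0" .

lemma mcoeff_homogeneous_part [simp]:
  "mcoeff (homogeneous_part n f) M = (if size M = n then mcoeff f M else 0)"
  by transfer simp

lemma homogeneous_part_Sym_deg: "f \<in> Sym \<Longrightarrow> homogeneous_part n f \<in> Sym_deg n"
  by (auto simp: Sym_deg_def homogeneous_def intro!: SymI[of _ n] split: if_splits simp: Sym_perm)

text \<open>Newton's identity solved for \<open>power_sum n\<close> reaches the power sums, their
  products span each degree by triangularity, and the degree bound in \<open>Sym\<close> makes
  \<open>f\<close> a finite sum of homogeneous parts.\<close>

lemma Sym_induct [consumes 1, case_names one complete_h add mscale times]: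
  assumes "f \<in> Sym"
    and one: "Q 1"
    and h: "\<And>r. r \<ge> 1 \<Longrightarrow> Q (complete_h r)"
    and add: "\<And>f g. f \<in> Sym \<Longrightarrow> g \<in> Sym \<Longrightarrow> Q f \<Longrightarrow> Q g \<Longrightarrow> Q (f + g)"
    and mscale: "\<And>c f. f \<in> Sym \<Longrightarrow> Q f \<Longrightarrow> Q (mscale c f)"
    and times: "\<And>f g. f \<in> Sym \<Longrightarrow> g \<in> Sym \<Longrightarrow> Q f \<Longrightarrow> Q g \<Longrightarrow> Q (f * g)"
  shows "Q f"
proof -
  have "mscale 0 1 = 0" by (rule mseries_eqI) simp
  then have zero: "Q 0" using mscale[OF Sym_1 one, of 0] by simp
  have sum: "Q (\<Sum>x\<in>A. g x)" if "\<And>x. x \<in> A \<Longrightarrow> g x \<in> Sym \<and> Q (g x)" for A and g :: "'b \<Rightarrow> mseries"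
    using that
  proof (induction A rule: infinite_finite_induct)
    case (insert x A)
    have "Q (g x + (\<Sum>x\<in>A. g x))" by (rule add) (use insert in auto)
    then show ?case using insert by simp
  qed (auto simp: zero)
  have power_sum: "Q (power_sum n)" if "n > 0" for n
    using that
  proof (induction n rule: less_induct)
    case (less n)
    have "complete_h 0 = 1" by (rule mseries_eqI) simp
    moreover have "{1..n} = insert n {1..<n}" using less.prems by auto
    ultimately have "mscale (of_nat n) (complete_h n)
        = power_sum n + (\<Sum>i=1..<n. power_sum i * complete_h (n - i))"
      unfolding newton_complete_h by simp
    moreover have "mscale (- 1) g = - g" for g by (rule mseries_eqI) simp
    ultimately have "power_sum n = mscale (of_nat n) (complete_h n)
        + mscale (- 1) (\<Sum>i=1..<n. power_sum i * complete_h (n - i))" by simp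
    moreover have "Q (power_sum i * complete_h (n - i))" if "i \<in> {1..<n}" for i
      using that less by (intro times h) auto
    then have "Q (\<Sum>i=1..<n. power_sum i * complete_h (n - i))"
      by (intro sum) auto
    ultimately show ?case
      using less.prems by (auto intro!: add mscale h)
  qed
  have power_sum_prod: "Q (power_sum_prod la)" if "0 \<notin> set la" for la
    using that
  proof (induction la)
    case (Cons a la)
    have "power_sum_prod la \<in> Sym" using power_sum_prod_Sym_deg Sym_deg_imp_Sym by blast
    with Cons show ?case by (auto simp: power_sum_prod_def intro!: times power_sum)
  qed (simp add: power_sum_prod_def one)
  have hom: "Q g" if "g \<in> Sym_deg n" for g n
  proof -
    have "\<exists>c. g = (\<Sum>la\<in>partitions_of n. mscale (c la) (power_sum_prod la))"
    proof (rule triangular_family_spans[where w = "int \<circ> length"])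
      fix la assume "la \<in> partitions_of n"
      then show "power_sum_prod la \<in> Sym_deg n"
        using power_sum_prod_Sym_deg[of la] by (simp add: partitions_of_def)
      show "mcoeff (power_sum_prod la) (partition_mset la) \<noteq> 0"
        using power_sum_prod_pos[of la "[0..<length la]"] by simp
    next
      fix la mu assume "la \<in> partitions_of n" "mu \<in> partitions_of n"
        "mcoeff (power_sum_prod la) (partition_mset mu) \<noteq> 0"
      then show "mu = la \<or> (int \<circ> length) mu < (int \<circ> length) la"
        using power_sum_prod_triangular by (auto simp: partitions_of_def)
    qed (rule that)
    then obtain c where c: "g = (\<Sum>la\<in>partitions_of n. mscale (c la) (power_sum_prod la))" ..
    have "power_sum_prod la \<in> Sym \<and> Q (power_sum_prod la)" if "la \<in> partitions_of n" for la
      using that power_sum_prod_Sym_deg[of la] Sym_deg_imp_Sym power_sum_prod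
      by (auto simp: partitions_of_def is_partition_def)
    then show ?thesis unfolding c by (intro sum) (auto intro!: mscale)
  qed
  obtain d where "\<forall>M. mcoeff f M \<noteq> 0 \<longrightarrow> size M \<le> d" using Sym_bound[OF assms(1)] by blast
  then have "f = (\<Sum>n\<le>d. homogeneous_part n f)"
    by (intro mseries_eqI) (auto simp: mcoeff_sum)
  moreover have "Q (\<Sum>n\<le>d. homogeneous_part n f)"
    using homogeneous_part_Sym_deg[OF assms(1)] Sym_deg_imp_Sym hom by (intro sum) blast
  ultimately show ?thesis by simp
qed

text \<open>The operators below are determined by their eigenvalues, so that existence and uniqueness of
  \<open>rho\<close> follow from generation of \<open>Sym\<close> by the complete homogeneous functions alone.\<close>

definition acts_as :: "mseries \<Rightarrow> (poly_xy \<Rightarrow> poly_xy) \<Rightarrow> bool" where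
  "acts_as f R \<longleftrightarrow> (\<forall>p k. ud_coeff (R p) k = principal_spec k f * ud_coeff p k)"

lemma principal_spec_1 [simp]: "principal_spec k 1 = 1"
proof -
  have "complete_h 0 = 1" by (rule mseries_eqI) simp
  then show ?thesis using principal_spec_complete_h[of k 0] by simp
qed

lemma acts_as_unique: "acts_as f R \<Longrightarrow> acts_as f R' \<Longrightarrow> R = R'"
  unfolding acts_as_def by (intro ext ud_coeff_inject) simp

lemma acts_as_intros:
  "acts_as 1 id"
  "acts_as (complete_h r) (G r)"
  "acts_as f R \<Longrightarrow> acts_as g R' \<Longrightarrow> acts_as (f + g) (\<lambda>p. R p + R' p)"
  "acts_as f R \<Longrightarrow> acts_as (mscale c f) (\<lambda>p. scale_xy c (R p))"
  "acts_as f R \<Longrightarrow> acts_as g R' \<Longrightarrow> acts_as (f * g) (R \<circ> R')"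
  by (simp_all add: acts_as_def ud_coeff_G ring_distribs mult.assoc)

lemma acts_as_linear:
  assumes "acts_as f R"
  shows "Vector_Spaces.linear scale_xy scale_xy R"
proof -
  have "R (p + q) = R p + R q" "R (scale_xy c p) = scale_xy c (R p)" for p q c
    using assms by (auto simp: acts_as_def ring_distribs intro!: ud_coeff_inject)
  then show ?thesis
    by (simp add: Vector_Spaces.linear_iff vector_space_scale_xy)
qed

lemma ex1_acts_as: "f \<in> Sym \<Longrightarrow> \<exists>!R. acts_as f R"
proof (rule ex_ex1I)
  assume "f \<in> Sym"
  then show "\<exists>R. acts_as f R"
    by (induction rule: Sym_induct) (blast intro: acts_as_intros)+
qed (rule acts_as_unique)

text \<open>The uniqueness half: any candidate has the prescribed eigenvalues on the generators,
  hence on all of \<open>Sym\<close>.\<close>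

lemma is_rho_acts_as:
  assumes R: "is_rho R" and "f \<in> Sym"
  shows "acts_as f (R f)"
  using assms(2)
proof (induction rule: Sym_induct)
  case one
  have "R 1 = id" using R by (simp add: is_rho_def)
  then show ?case by (simp only: acts_as_intros(1))
next
  case (complete_h r)
  then show ?case using R acts_as_intros(2) by (simp add: is_rho_def)
next
  case (add f g)
  then show ?case using R acts_as_intros(3) by (simp add: is_rho_def)
next
  case (mscale c f)
  then show ?case using R acts_as_intros(4) by (simp add: is_rho_def)
next
  case (times f g)
  then have "R (f * g) = R f \<circ> R g" using R by (simp add: is_rho_def)
  with times show ?case by (simp only: acts_as_intros(5))
qed

lemma is_rho_rho: "is_rho rho"
  unfolding rho_def
proof (rule theI[where P = is_rho])
  define R0 where "R0 = (\<lambda>f\<in>Sym. THE R. acts_as f R)"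
  have R0: "acts_as f (R0 f)" if "f \<in> Sym" for f
    using theI'[OF ex1_acts_as[OF that]] that by (simp add: R0_def)
  have eq: "R0 f = R" if "f \<in> Sym" "acts_as f R" for f R
    using acts_as_unique[OF R0] that by blast
  show "is_rho R0"
    unfolding is_rho_def
  proof (intro conjI ballI allI impI)
    show "R0 \<in> extensional Sym" by (simp add: R0_def)
    show "Vector_Spaces.linear scale_xy scale_xy (R0 f)" if "f \<in> Sym" for f
      using R0[OF that] by (rule acts_as_linear)
  qed (auto intro!: eq acts_as_intros R0)
  show "R = R0" if "is_rho R" for R
  proof (rule extensionalityI)
    show "R \<in> extensional Sym" using that by (simp add: is_rho_def)
    show "R f = R0 f" if "f \<in> Sym" for f
      using acts_as_unique is_rho_acts_as[OF \<open>is_rho R\<close>] R0 that by blast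
  qed (simp add: R0_def)
qed

lemma ud_coeff_rho: "f \<in> Sym \<Longrightarrow> ud_coeff (rho f p) k = principal_spec k f * ud_coeff p k"
  using is_rho_acts_as[OF is_rho_rho] by (simp add: acts_as_def)

lemma Phi_times:
  assumes "g \<in> Sym_deg m" "f \<in> QSym N"
  shows "Phi (N + m) (g * f) = rho g (Phi N f)"
  using assms
  by (intro ud_coeff_inject)
    (simp add: ud_coeff_Phi Sym_deg_times_QSym ud_coeff_rho Sym_deg_imp_Sym mult.left_commute)

section \<open>Schur functions\<close>

text \<open>Padding with zeros keeps the interlacing inequalities uniform beyond the last
  row.\<close>

definition row_length :: "nat list \<Rightarrow> nat \<Rightarrow> nat" where
  "row_length la i = (if i < length la then la ! i else 0)"

lemma cells_iff: "(i, j) \<in> cells la \<longleftrightarrow> j < row_length la i"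
  by (simp add: cells_def row_length_def)

lemma cells_eq_Sigma: "cells la = (SIGMA i:{..<length la}. {..<la ! i})"
  by (auto simp: cells_def)

lemma finite_cells [simp]: "finite (cells la)"
  by (simp add: cells_eq_Sigma)

lemma card_cells: "card (cells la) = sum_list la"
  by (simp add: cells_eq_Sigma card_SigmaI sum_list_sum_nth lessThan_atLeast0)

lemma row_length_Suc_le: "is_partition la \<Longrightarrow> row_length la (Suc i) \<le> row_length la i"
  by (auto simp: row_length_def is_partition_def sorted_wrt_iff_nth_less)

lemma ssyt_extensional: "T \<in> ssyt la \<Longrightarrow> T \<in> extensional (cells la)"
  by (simp add: ssyt_def)

lemma ssyt_row:
  assumes "T \<in> ssyt la" "j < j'" "j' < row_length la i"
  shows "T (i, j) \<le> T (i, j')"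
proof -
  have "j < row_length la i" using assms by simp
  then show ?thesis using assms by (simp add: ssyt_def cells_iff)
qed

lemma ssyt_column:
  assumes "is_partition la" "T \<in> ssyt la" "j < row_length la (Suc i)"
  shows "T (i, j) < T (Suc i, j)"
proof -
  have "j < row_length la i" using row_length_Suc_le[OF assms(1), of i] assms(3) by simp
  then show ?thesis using assms(2,3) by (simp add: ssyt_def cells_iff)
qed

abbreviation content :: "nat list \<Rightarrow> (nat \<times> nat \<Rightarrow> nat) \<Rightarrow> nat multiset" where
  "content la T \<equiv> image_mset T (mset_set (cells la))"

text \<open>Entries come from the support of \<open>M\<close>. Finiteness matters because
  \<open>card\<close> is 0 on infinite sets.\<close>

lemma finite_ssyt_content: "finite {T \<in> ssyt la. content la T = M}"
proof (rule finite_subset)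
  show "{T \<in> ssyt la. content la T = M} \<subseteq> cells la \<rightarrow>\<^sub>E set_mset M"
    by (auto dest: ssyt_extensional simp: PiE_def)
qed (simp add: finite_PiE)

lemma mcoeff_schur: "mcoeff (schur la) M = of_nat (card {T \<in> ssyt la. content la T = M})"
  by transfer simp

lemma mcoeff_schur_nonzeroE:
  assumes "mcoeff (schur la) M \<noteq> 0"
  obtains T where "T \<in> ssyt la" "content la T = M"
proof -
  have "card {T \<in> ssyt la. content la T = M} \<noteq> 0"
    using assms unfolding mcoeff_schur by (simp only: of_nat_eq_0_iff not_False_eq_True)
  then have "{T \<in> ssyt la. content la T = M} \<noteq> {}" by (metis card.empty)
  then show ?thesis using that by blast
qed

lemma homogeneous_schur: "homogeneous (sum_list la) (schur la)"
  unfolding homogeneous_def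
proof (intro allI impI)
  fix M assume "mcoeff (schur la) M \<noteq> 0"
  then obtain T where "content la T = M" by (rule mcoeff_schur_nonzeroE)
  then have "size M = card (cells la)" by auto
  then show "size M = sum_list la" by (simp only: card_cells)
qed

lemma count_image_mset_set:
  assumes "finite A"
  shows "count (image_mset T (mset_set A)) k = card {c \<in> A. T c = k}"
proof -
  have "count (image_mset T (mset_set A)) k = (\<Sum>c\<in>{c \<in> A. T c = k}. 1)"
    unfolding count_image_mset' by (rule sum.cong) (use assms in auto)
  then show ?thesis by simp
qed

text \<open>A tableau is encoded by its Gelfand--Tsetlin pattern: entry \<open>(k, i)\<close> counts the entries
  less than \<open>k\<close> in row \<open>i\<close>.\<close>

definition gt_pattern :: "nat list \<Rightarrow> (nat \<times> nat \<Rightarrow> nat) \<Rightarrow> nat \<Rightarrow> nat \<Rightarrow> nat" where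
  "gt_pattern la T k i = card {j. j < row_length la i \<and> T (i, j) < k}"

text \<open>Level k is the shape filled by the entries below k, and consecutive levels differ by a
  horizontal strip. Stabilisation takes the place of a fixed bound on the entries.\<close>

definition gt_patterns :: "nat list \<Rightarrow> (nat \<Rightarrow> nat \<Rightarrow> nat) set" where
  "gt_patterns la = {r. (\<forall>i. r 0 i = 0) \<and> (\<forall>k i. r k i \<le> r (Suc k) i) \<and>
     (\<forall>k i. r (Suc k) (Suc i) \<le> r k i) \<and> (\<exists>K. \<forall>k\<ge>K. \<forall>i. r k i = row_length la i)}"

text \<open>A cell carries the entry k when it lies in level k + 1 but not in level k.\<close>

definition gt_tableau :: "nat list \<Rightarrow> (nat \<Rightarrow> nat \<Rightarrow> nat) \<Rightarrow> nat \<times> nat \<Rightarrow> nat" where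
  "gt_tableau la r = (\<lambda>(i, j)\<in>cells la. LEAST k. j < r (Suc k) i)"

text \<open>Rows increase weakly, so the entries below k occupy an initial segment of the row, which
  its length determines.\<close>

lemma less_gt_pattern_iff:
  assumes "T \<in> ssyt la"
  shows "j < gt_pattern la T k i \<longleftrightarrow> j < row_length la i \<and> T (i, j) < k"
proof -
  let ?A = "{j. j < row_length la i \<and> T (i, j) < k}"
  have "j \<in> ?A" if "j \<le> j'" "j' \<in> ?A" for j j'
    using that ssyt_row[OF assms, of j j' i] by (cases "j = j'") auto
  moreover have "finite ?A" by simp
  ultimately have "?A = {..<card ?A}"
  proof -
    assume down: "\<And>j j'. j \<le> j' \<Longrightarrow> j' \<in> ?A \<Longrightarrow> j \<in> ?A" and fin: "finite ?A"
    have "?A \<subseteq> {..<card ?A}"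
    proof
      fix j assume "j \<in> ?A"
      then have "{..j} \<subseteq> ?A" using down by blast
      then have "card {..j} \<le> card ?A" using fin card_mono by blast
      then show "j \<in> {..<card ?A}" by simp
    qed
    then show ?thesis by (intro card_subset_eq) auto
  qed
  from arg_cong[OF this, of "\<lambda>S. j \<in> S"] show ?thesis by (simp add: gt_pattern_def)
qed

lemma nat_leI:
  fixes a b :: nat
  assumes "\<And>j. j < a \<Longrightarrow> j < b"
  shows "a \<le> b"
  using assms[of b] by (cases "b < a") auto

lemma gt_pattern_in_gt_patterns:
  assumes la: "is_partition la" and T: "T \<in> ssyt la"
  shows "gt_pattern la T \<in> gt_patterns la"
proof -
  note iff = less_gt_pattern_iff[OF T]
  have "gt_pattern la T 0 i = 0" for i by (simp add: gt_pattern_def)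
  moreover have "gt_pattern la T k i \<le> gt_pattern la T (Suc k) i" for k i
    by (rule nat_leI) (simp add: iff)
  moreover have "gt_pattern la T (Suc k) (Suc i) \<le> gt_pattern la T k i" for k i
  proof (rule nat_leI)
    fix j assume "j < gt_pattern la T (Suc k) (Suc i)"
    then have "j < row_length la (Suc i)" "T (Suc i, j) < Suc k" by (simp_all add: iff)
    then show "j < gt_pattern la T k i"
      using ssyt_column[OF la T] row_length_Suc_le[OF la, of i] by (fastforce simp: iff)
  qed
  moreover have "\<exists>K. \<forall>k\<ge>K. \<forall>i. gt_pattern la T k i = row_length la i"
  proof -
    have "finite (T ` cells la)" by simp
    then obtain K where "\<forall>t\<in>T ` cells la. t < K" by (meson finite_nat_set_iff_bounded)
    then have K: "T (i, j) < K" if "j < row_length la i" for i j using that by (auto simp: cells_iff)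
    have "gt_pattern la T k i = row_length la i" if "k \<ge> K" for k i
    proof (rule antisym; rule nat_leI)
      show "j < gt_pattern la T k i" if "j < row_length la i" for j
        using K[OF that] that \<open>k \<ge> K\<close> by (simp add: iff)
    qed (simp add: iff)
    then show ?thesis by blast
  qed
  ultimately show ?thesis by (auto simp: gt_patterns_def)
qed

lemma gt_patternsD:
  assumes "r \<in> gt_patterns la"
  shows "r 0 i = 0" "r k i \<le> r (Suc k) i" "r (Suc k) (Suc i) \<le> r k i" "r k i \<le> row_length la i"
    and "k \<le> k' \<Longrightarrow> r k i \<le> r k' i" and "i < i' \<Longrightarrow> r (Suc k) i' \<le> r k i"
    and "\<exists>K. \<forall>k\<ge>K. \<forall>i. r k i = row_length la i"
proof -
  show basic: "r 0 i = 0" "r k i \<le> r (Suc k) i" "r (Suc k) (Suc i) \<le> r k i"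
    "\<exists>K. \<forall>k\<ge>K. \<forall>i. r k i = row_length la i" for k i
    using assms by (auto simp: gt_patterns_def)
  show mono: "r k i \<le> r k' i" if "k \<le> k'" for k k' i
    using that by (rule lift_Suc_mono_le[of "\<lambda>k. r k i", rotated]) (rule basic)
  show "r k i \<le> row_length la i"
  proof -
    obtain K where "\<forall>k\<ge>K. \<forall>i. r k i = row_length la i" using basic(4) by blast
    then show ?thesis using mono[of k "max k K" i] by simp
  qed
  show "r (Suc k) i' \<le> r k i" if "i < i'"
  proof -
    have "r (Suc k) (Suc m) \<le> r (Suc k) m" for m
      using basic(2)[of "Suc k" "Suc m"] basic(3)[of "Suc k" m] by linarith
    then have "r (Suc k) i' \<le> r (Suc k) (Suc i)"
      by (rule lift_Suc_antimono_le) (use that in simp)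
    then show ?thesis using basic(3)[of k i] by simp
  qed
qed

lemma gt_tableau_less_iff:
  assumes r: "r \<in> gt_patterns la" and j: "j < row_length la i"
  shows "gt_tableau la r (i, j) < k \<longleftrightarrow> j < r k i"
proof -
  let ?m = "LEAST k. j < r (Suc k) i"
  obtain K where "\<forall>k\<ge>K. \<forall>i. r k i = row_length la i" using gt_patternsD(7)[OF r] by blast
  then have "j < r (Suc K) i" using j by simp
  then have m: "j < r (Suc ?m) i" by (rule LeastI[of "\<lambda>k. j < r (Suc k) i"])
  have "?m < k \<longleftrightarrow> j < r k i"
  proof
    assume "?m < k"
    then have "r (Suc ?m) i \<le> r k i" by (intro gt_patternsD(5)[OF r]) simp
    with m show "j < r k i" by simp
  next
    assume less: "j < r k i"
    then obtain k' where k': "k = Suc k'" using gt_patternsD(1)[OF r] by (cases k) auto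
    then have "?m \<le> k'" using less by (intro Least_le) simp
    then show "?m < k" using k' by simp
  qed
  then show ?thesis using j by (simp add: gt_tableau_def cells_iff)
qed

lemma gt_tableau_ssyt:
  assumes r: "r \<in> gt_patterns la"
  shows "gt_tableau la r \<in> ssyt la"
proof -
  let ?T = "gt_tableau la r"
  note iff = gt_tableau_less_iff[OF r]
  have "?T (i, j) \<le> ?T (i, j')" if "j' < row_length la i" "j < j'" for i j j'
  proof -
    have "j' < r (Suc (?T (i, j'))) i" using iff[OF that(1), of "Suc (?T (i, j'))"] by simp
    then have "j < r (Suc (?T (i, j'))) i" using that by simp
    then show ?thesis using iff[of j i "Suc (?T (i, j'))"] that by simp
  qed
  moreover have "?T (i, j) < ?T (i', j)"
    if "j < row_length la i" "j < row_length la i'" "i < i'" for i i' j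
  proof -
    have "j < r (Suc (?T (i', j))) i'" using iff[OF that(2), of "Suc (?T (i', j))"] by simp
    then have "j < r (?T (i', j)) i" using gt_patternsD(6)[OF r that(3), of "?T (i', j)"] by simp
    then show ?thesis using iff[OF that(1)] by simp
  qed
  moreover have "?T \<in> extensional (cells la)" by (simp add: gt_tableau_def)
  ultimately show ?thesis by (simp add: ssyt_def cells_iff)
qed

lemma gt_pattern_gt_tableau:
  assumes r: "r \<in> gt_patterns la"
  shows "gt_pattern la (gt_tableau la r) = r"
proof (intro ext)
  fix k i
  have "j < gt_pattern la (gt_tableau la r) k i \<longleftrightarrow> j < r k i" for j
    using gt_tableau_less_iff[OF r] gt_patternsD(4)[OF r, of k i]
    by (auto simp: less_gt_pattern_iff[OF gt_tableau_ssyt[OF r]])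
  then show "gt_pattern la (gt_tableau la r) k i = r k i"
    by (intro antisym nat_leI) simp_all
qed

lemma gt_pattern_inject:
  assumes "T \<in> ssyt la" "T' \<in> ssyt la" "gt_pattern la T = gt_pattern la T'"
  shows "T = T'"
proof (rule extensionalityI)
  fix c assume "c \<in> cells la"
  then obtain i j where c: "c = (i, j)" "j < row_length la i" by (cases c) (auto simp: cells_iff)
  have "T c < k \<longleftrightarrow> T' c < k" for k
    using less_gt_pattern_iff[OF assms(1), of j k i] less_gt_pattern_iff[OF assms(2), of j k i] assms(3) c
    by simp
  from this[of "T c"] this[of "T' c"] show "T c = T' c" by simp
qed (rule ssyt_extensional[OF assms(1)], rule ssyt_extensional[OF assms(2)])

text \<open>The entries equal to k fill the cells between two consecutive levels; the additive form
  avoids truncated subtraction.\<close>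

lemma count_content:
  assumes T: "T \<in> ssyt la"
  shows "count (content la T) k + (\<Sum>i<length la. gt_pattern la T k i)
    = (\<Sum>i<length la. gt_pattern la T (Suc k) i)"
proof -
  have sum: "(\<Sum>i<length la. gt_pattern la T k i) = card {c \<in> cells la. T c < k}" for k
  proof -
    have "(i, j) \<in> {c \<in> cells la. T c < k} \<longleftrightarrow> i < length la \<and> j < gt_pattern la T k i" for i j
      by (auto simp: less_gt_pattern_iff[OF T] cells_iff) (auto simp: row_length_def split: if_splits)
    then have "{c \<in> cells la. T c < k} = (SIGMA i:{..<length la}. {..<gt_pattern la T k i})"
      by auto
    then show ?thesis by (simp add: card_SigmaI)
  qed
  have "count (content la T) k = card {c \<in> cells la. T c = k}"
    by (rule count_image_mset_set) simp
  moreover have "{c \<in> cells la. T c < Suc k} = {c \<in> cells la. T c = k} \<union> {c \<in> cells la. T c < k}"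
    by auto
  moreover have "card ({c \<in> cells la. T c = k} \<union> {c \<in> cells la. T c < k})
      = card {c \<in> cells la. T c = k} + card {c \<in> cells la. T c < k}"
    by (rule card_Un_disjoint) auto
  ultimately show ?thesis by (simp only: sum)
qed

text \<open>With the levels \<open>a\<close> and \<open>a + 2\<close> of a pattern fixed, the entries of level \<open>a + 1\<close> range
  independently over the intervals \<open>[gt_lower a r i, gt_upper a r i]\<close>; the Bender--Knuth
  involution reflects each of these intervals.\<close>

definition gt_lower :: "nat \<Rightarrow> (nat \<Rightarrow> nat \<Rightarrow> nat) \<Rightarrow> nat \<Rightarrow> nat" where
  "gt_lower a r i = max (r a i) (r (Suc (Suc a)) (Suc i))"

definition gt_upper :: "nat \<Rightarrow> (nat \<Rightarrow> nat \<Rightarrow> nat) \<Rightarrow> nat \<Rightarrow> nat" where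
  "gt_upper a r i = (if i = 0 then r (Suc (Suc a)) 0 else min (r (Suc (Suc a)) i) (r a (i - 1)))"

definition bender_knuth :: "nat \<Rightarrow> (nat \<Rightarrow> nat \<Rightarrow> nat) \<Rightarrow> nat \<Rightarrow> nat \<Rightarrow> nat" where
  "bender_knuth a r = r(Suc a := \<lambda>i. gt_lower a r i + gt_upper a r i - r (Suc a) i)"

lemma gt_bounds:
  assumes "r \<in> gt_patterns la"
  shows "gt_lower a r i \<le> r (Suc a) i" "r (Suc a) i \<le> gt_upper a r i"
  using gt_patternsD(2,3)[OF assms] by (cases i; simp add: gt_lower_def gt_upper_def)+

lemma bender_knuth_bounds:
  assumes "r \<in> gt_patterns la"
  shows "gt_lower a r i \<le> bender_knuth a r (Suc a) i" "bender_knuth a r (Suc a) i \<le> gt_upper a r i"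
  using gt_bounds[OF assms, of a i] by (simp_all add: bender_knuth_def)

lemma bender_knuth_other: "k \<noteq> Suc a \<Longrightarrow> bender_knuth a r k = r k"
  by (simp add: bender_knuth_def)

lemma bender_knuth_gt_patterns:
  assumes r: "r \<in> gt_patterns la"
  shows "bender_knuth a r \<in> gt_patterns la"
proof -
  let ?r = "bender_knuth a r"
  note bounds = bender_knuth_bounds[OF r, of a]
  have "?r 0 i = 0" for i by (simp add: bender_knuth_other gt_patternsD(1)[OF r])
  moreover have "?r k i \<le> ?r (Suc k) i" for k i
  proof -
    consider "k = a" | "k = Suc a" | "k \<noteq> a" "k \<noteq> Suc a" by blast
    then show ?thesis
      using bounds[of i] gt_patternsD(2)[OF r, of k i]
      by cases (auto simp: bender_knuth_other gt_lower_def gt_upper_def split: if_splits)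
  qed
  moreover have "?r (Suc k) (Suc i) \<le> ?r k i" for k i
  proof -
    consider "k = a" | "k = Suc a" | "k \<noteq> a" "k \<noteq> Suc a" by blast
    then show ?thesis
      using bounds[of i] bounds[of "Suc i"] gt_patternsD(3)[OF r, of k i]
      by cases (auto simp: bender_knuth_other gt_lower_def gt_upper_def)
  qed
  moreover have "\<exists>K. \<forall>k\<ge>K. \<forall>i. ?r k i = row_length la i"
  proof -
    obtain K where "\<forall>k\<ge>K. \<forall>i. r k i = row_length la i" using gt_patternsD(7)[OF r] by blast
    then show ?thesis
      by (intro exI[of _ "max K (Suc (Suc a))"]) (auto simp: bender_knuth_other)
  qed
  ultimately show ?thesis by (simp add: gt_patterns_def)
qed

text \<open>The interval ends depend only on the levels a and a + 2, which the reflection leaves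
  alone.\<close>

lemma bender_knuth_involution:
  assumes r: "r \<in> gt_patterns la"
  shows "bender_knuth a (bender_knuth a r) = r"
proof -
  have "gt_lower a (bender_knuth a r) = gt_lower a r" "gt_upper a (bender_knuth a r) = gt_upper a r"
    by (auto simp: gt_lower_def gt_upper_def bender_knuth_other fun_eq_iff)
  moreover have "gt_lower a r i + gt_upper a r i - (gt_lower a r i + gt_upper a r i - r (Suc a) i)
      = r (Suc a) i" for i
    using gt_bounds(2)[OF r, of a i] by simp
  ultimately show ?thesis by (auto simp: bender_knuth_def fun_eq_iff)
qed

text \<open>The lower end in row i and the upper end in row i + 1 are the maximum and the minimum of
  the same two numbers, so they add up to their sum. The first upper end and the last lower end
  supply the two unpaired terms.\<close>

lemma sum_bender_knuth:
  assumes r: "r \<in> gt_patterns la"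
  shows "(\<Sum>i<length la. bender_knuth a r (Suc a) i) + (\<Sum>i<length la. r (Suc a) i)
    = (\<Sum>i<length la. r a i) + (\<Sum>i<length la. r (Suc (Suc a)) i)"
proof -
  have "(\<Sum>i<length la. bender_knuth a r (Suc a) i) + (\<Sum>i<length la. r (Suc a) i)
      = (\<Sum>i<length la. gt_lower a r i) + (\<Sum>i<length la. gt_upper a r i)"
    unfolding sum.distrib[symmetric]
  proof (rule sum.cong)
    fix i
    show "bender_knuth a r (Suc a) i + r (Suc a) i = gt_lower a r i + gt_upper a r i"
      using gt_bounds[OF r, of a i] by (simp add: bender_knuth_def)
  qed simp
  also have "\<dots> = (\<Sum>i<length la. r a i) + (\<Sum>i<length la. r (Suc (Suc a)) i)"
  proof (cases "length la")
    case (Suc n)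
    have "r (Suc (Suc a)) (Suc n) = 0"
      using gt_patternsD(4)[OF r, of "Suc (Suc a)" "Suc n"] Suc by (simp add: row_length_def)
    then have "gt_lower a r n = r a n" by (simp add: gt_lower_def)
    moreover have "(\<Sum>i<n. gt_lower a r i) + (\<Sum>i<n. gt_upper a r (Suc i))
        = (\<Sum>i<n. r a i) + (\<Sum>i<n. r (Suc (Suc a)) (Suc i))"
      unfolding sum.distrib[symmetric]
      by (rule sum.cong) (auto simp: gt_lower_def gt_upper_def max_def min_def)
    moreover have "gt_upper a r 0 = r (Suc (Suc a)) 0" by (simp add: gt_upper_def)
    moreover have "(\<Sum>i<Suc n. gt_upper a r i) = gt_upper a r 0 + (\<Sum>i<n. gt_upper a r (Suc i))"
      "(\<Sum>i<Suc n. r (Suc (Suc a)) i) = r (Suc (Suc a)) 0 + (\<Sum>i<n. r (Suc (Suc a)) (Suc i))"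
      by (rule sum.lessThan_Suc_shift)+
    ultimately show ?thesis
      unfolding Suc by (simp only: sum.lessThan_Suc[of "gt_lower a r"] sum.lessThan_Suc[of "r a"])
  qed simp
  finally show ?thesis .
qed

section \<open>Symmetry of the Schur functions\<close>

lemma count_image_transpose:
  "count (image_mset (Transposition.transpose a b) M) x = count M (Transposition.transpose a b x)"
proof (induction M)
  case (add y M)
  have "Transposition.transpose a b y = x \<longleftrightarrow> y = Transposition.transpose a b x"
    by (auto simp: transpose_def)
  then show ?case using add by simp
qed simp

text \<open>The multiplicities of a and a + 1 are the size differences around level a + 1, and the
  reflection exchanges them. An injection in one direction is enough, since the swap is its own
  inverse.\<close>

lemma mcoeff_schur_adjacent_le:
  assumes la: "is_partition la"
  shows "card {T \<in> ssyt la. content la T = M}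
    \<le> card {T \<in> ssyt la. content la T = image_mset (Transposition.transpose a (Suc a)) M}"
proof (rule card_inj_on_le[OF _ _ finite_ssyt_content])
  let ?\<beta> = "\<lambda>T. gt_tableau la (bender_knuth a (gt_pattern la T))"
  have \<beta>: "?\<beta> T \<in> ssyt la" "gt_pattern la (?\<beta> T) = bender_knuth a (gt_pattern la T)"
    if "T \<in> ssyt la" for T
    using gt_pattern_in_gt_patterns[OF la that]
    by (simp_all add: gt_tableau_ssyt gt_pattern_gt_tableau bender_knuth_gt_patterns)
  show "inj_on ?\<beta> {T \<in> ssyt la. content la T = M}"
  proof (rule inj_onI)
    fix T T' assume "T \<in> {T \<in> ssyt la. content la T = M}" "T' \<in> {T \<in> ssyt la. content la T = M}"
      and eq: "?\<beta> T = ?\<beta> T'"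
    then have T: "T \<in> ssyt la" "T' \<in> ssyt la" by auto
    have "bender_knuth a (gt_pattern la T) = bender_knuth a (gt_pattern la T')"
      using arg_cong[OF eq, of "gt_pattern la"] unfolding \<beta>(2)[OF T(1)] \<beta>(2)[OF T(2)] .
    from arg_cong[OF this, of "bender_knuth a"] have "gt_pattern la T = gt_pattern la T'"
      unfolding bender_knuth_involution[OF gt_pattern_in_gt_patterns[OF la T(1)]]
        bender_knuth_involution[OF gt_pattern_in_gt_patterns[OF la T(2)]] .
    with T show "T = T'" by (rule gt_pattern_inject)
  qed
  have "content la (?\<beta> T) = image_mset (Transposition.transpose a (Suc a)) (content la T)" if T: "T \<in> ssyt la" for T
  proof (rule multiset_eqI)
    fix x
    let ?c = "count (content la T)" and ?c' = "count (content la (?\<beta> T))"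
    define S where "S k = (\<Sum>i<length la. gt_pattern la T k i)" for k
    define S' where "S' k = (\<Sum>i<length la. bender_knuth a (gt_pattern la T) k i)" for k
    have c: "?c k + S k = S (Suc k)" for k
      unfolding S_def by (rule count_content[OF T])
    have c': "?c' k + S' k = S' (Suc k)" for k
      using count_content[OF \<beta>(1)[OF T], of k] unfolding \<beta>(2)[OF T] S'_def .
    have other: "S' k = S k" if "k \<noteq> Suc a" for k
      using that by (simp add: S_def S'_def bender_knuth_other)
    have level: "S' (Suc a) + S (Suc a) = S a + S (Suc (Suc a))"
      unfolding S_def S'_def by (rule sum_bender_knuth[OF gt_pattern_in_gt_patterns[OF la T]])
    consider "x = a" | "x = Suc a" | "x \<noteq> a" "x \<noteq> Suc a" by blast
    then have "?c' x = ?c (Transposition.transpose a (Suc a) x)"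
    proof cases
      case 1
      then show ?thesis using c[of "Suc a"] c'[of a] other[of a] level by simp
    next
      case 2
      then show ?thesis using c[of a] c'[of "Suc a"] other[of "Suc (Suc a)"] level by simp
    next
      case 3
      then show ?thesis using c[of x] c'[of x] other[of x] other[of "Suc x"] by simp
    qed
    then show "?c' x = count (image_mset (Transposition.transpose a (Suc a)) (content la T)) x"
      by (simp only: count_image_transpose)
  qed
  then show "?\<beta> ` {T \<in> ssyt la. content la T = M}
      \<subseteq> {T \<in> ssyt la. content la T = image_mset (Transposition.transpose a (Suc a)) M}"
    using \<beta>(1) by blast
qed

lemma mcoeff_schur_adjacent:
  assumes "is_partition la"
  shows "mcoeff (schur la) (image_mset (Transposition.transpose a (Suc a)) M) = mcoeff (schur la) M"
proof -
  have "image_mset (Transposition.transpose a (Suc a)) (image_mset (Transposition.transpose a (Suc a)) M) = M"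
    by (simp add: multiset.map_comp)
  then show ?thesis
    using mcoeff_schur_adjacent_le[OF assms, of M a]
      mcoeff_schur_adjacent_le[OF assms, of "image_mset (Transposition.transpose a (Suc a)) M" a]
    by (simp add: mcoeff_schur)
qed

text \<open>Adjacent swaps generate all transpositions, these generate the finitely supported
  permutations, and on a single monomial every bijection agrees with one of the latter.\<close>

lemma Sym_degI_adjacent:
  assumes hom: "homogeneous n f"
    and adj: "\<And>a M. mcoeff f (image_mset (Transposition.transpose a (Suc a)) M) = mcoeff f M"
  shows "f \<in> Sym_deg n"
proof (rule homogeneous_Sym_degI[OF hom])
  have ordered: "mcoeff f (image_mset (Transposition.transpose a (Suc (a + d))) M) = mcoeff f M" for a d M
  proof (induction d arbitrary: M)
    case (Suc d)
    let ?b = "Suc (a + d)"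
    \<comment> \<open>Conjugation: with c = b + 1, the swap of a and c is (b c)(a b)(b c).\<close>
    have "image_mset (Transposition.transpose a (Suc ?b)) M
        = image_mset (Transposition.transpose ?b (Suc ?b)) (image_mset (Transposition.transpose a ?b) (image_mset (Transposition.transpose ?b (Suc ?b)) M))"
      unfolding multiset.map_comp
      by (rule image_mset_cong) (auto simp: transpose_def)
    then show ?case by (simp only: adj Suc.IH add_Suc_right)
  qed (simp add: adj)
  have transp: "mcoeff f (image_mset (Transposition.transpose a b) M) = mcoeff f M" for a b M
  proof (cases a b rule: linorder_cases)
    case less
    then obtain d where "b = Suc (a + d)" using less_imp_Suc_add by blast
    then show ?thesis using ordered by simp
  next
    case greater
    then obtain d where "a = Suc (b + d)" using less_imp_Suc_add by blast
    then show ?thesis using ordered[of b d M] by (simp add: transpose_commute)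
  qed simp
  fix \<pi> :: "nat \<Rightarrow> nat" and M assume "bij \<pi>"
  then have "inj_on \<pi> (set_mset M)" by (meson bij_is_inj inj_on_subset subset_UNIV)
  from extend_inj_on_to_permutation[OF finite_set_mset this]
  obtain p U where p: "finite U" "p permutes U" "\<forall>x\<in>set_mset M. p x = \<pi> x" by blast
  have "mcoeff f (image_mset p M) = mcoeff f M"
    using p(2,1)
  proof (induction rule: permutes_induct)
    case (swap a b p)
    have "image_mset (Transposition.transpose a b \<circ> p) M = image_mset (Transposition.transpose a b) (image_mset p M)"
      by (simp add: multiset.map_comp)
    then show ?case using swap by (simp only: transp)
  qed simp
  moreover have "image_mset \<pi> M = image_mset p M" using p(3) by (intro image_mset_cong) auto
  ultimately show "mcoeff f (image_mset \<pi> M) = mcoeff f M" by simp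
qed

lemma schur_Sym_deg: "is_partition la \<Longrightarrow> schur la \<in> Sym_deg (sum_list la)"
  by (intro Sym_degI_adjacent homogeneous_schur mcoeff_schur_adjacent)

section \<open>Triangularity of the Schur functions and the Littlewood-Richardson expansion\<close>

lemma count_partition_mset: "count (partition_mset la) i = row_length la i"
  using weighted_mset_map_count[of "[0..<length la]" "(!) la" i]
  by (simp add: map_nth row_length_def)

lemma partition_mset_inject:
  assumes "is_partition la" "is_partition mu" "partition_mset la = partition_mset mu"
  shows "la = mu"
proof -
  have "{..<length nu} = set_mset (partition_mset nu)" if "is_partition nu" for nu
    using that by (simp add: set_weighted_mset is_partition_def lessThan_atLeast0)
  then have "length la = length mu" using assms by (metis card_lessThan)
  moreover have "row_length la i = row_length mu i" for i
    using assms(3) by (simp flip: count_partition_mset)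
  ultimately show ?thesis by (metis nth_equalityI row_length_def)
qed

text \<open>Read as a filling, \<open>fst\<close> puts i throughout row i: the extremal tableau
  behind the diagonal coefficient and the lower bound on entries.\<close>

lemma content_fst: "content la fst = partition_mset la"
proof (rule multiset_eqI)
  fix i
  have "{c \<in> cells la. fst c = i} = Pair i ` {..<row_length la i}"
    by (auto simp: cells_iff)
  then have "card {c \<in> cells la. fst c = i} = row_length la i"
    by (simp add: card_image inj_on_def)
  moreover have "count (content la fst) i = card {c \<in> cells la. fst c = i}"
    by (rule count_image_mset_set) simp
  ultimately show "count (content la fst) i = count (partition_mset la) i"
    by (simp add: count_partition_mset)
qed

lemma ssyt_ge_row:
  assumes "is_partition la" "T \<in> ssyt la"
  shows "j < row_length la i \<Longrightarrow> i \<le> T (i, j)"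
proof (induction i)
  case (Suc i)
  then have "T (i, j) < T (Suc i, j)" using ssyt_column[OF assms] by blast
  moreover have "i \<le> T (i, j)" using Suc row_length_Suc_le[OF assms(1), of i] by simp
  ultimately show ?case by simp
qed simp

text \<open>The entries in row \<open>i\<close> of a semistandard tableau are at least \<open>i\<close>, so the sum of all entries
  is minimal exactly for the tableau whose row \<open>i\<close> is constantly \<open>i\<close>.\<close>

lemma schur_triangular:
  assumes "is_partition la" "is_partition mu" "mcoeff (schur la) (partition_mset mu) \<noteq> 0"
  shows "mu = la \<or> sum_mset (partition_mset la) < sum_mset (partition_mset mu)"
proof -
  obtain T where T: "T \<in> ssyt la" "content la T = partition_mset mu"
    using assms(3) by (rule mcoeff_schur_nonzeroE)
  have ge: "fst c \<le> T c" if "c \<in> cells la" for c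
    using that ssyt_ge_row[OF assms(1) T(1)] by (cases c) (auto simp: cells_iff)
  have weight: "sum_mset (partition_mset la) = (\<Sum>c\<in>cells la. fst c)"
    "sum_mset (partition_mset mu) = (\<Sum>c\<in>cells la. T c)"
    by (simp_all add: sum_unfold_sum_mset content_fst T(2))
  show ?thesis
  proof (cases "\<exists>c\<in>cells la. fst c < T c")
    case True
    then show ?thesis unfolding weight using ge by (intro disjI2 sum_strict_mono_ex1) auto
  next
    case False
    then have "content la T = content la fst"
      using ge by (intro image_mset_cong) (auto intro: antisym simp: not_less)
    then show ?thesis using partition_mset_inject assms(1,2) T(2) content_fst by metis
  qed
qed

lemma schur_diagonal: "mcoeff (schur la) (partition_mset la) \<noteq> 0"
proof -
  let ?T = "restrict fst (cells la)"
  have "?T \<in> ssyt la" by (auto simp: ssyt_def)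
  moreover have "content la ?T = content la fst" by (rule image_mset_cong) auto
  ultimately have "?T \<in> {T \<in> ssyt la. content la T = partition_mset la}"
    by (simp add: content_fst)
  then show ?thesis
    using finite_ssyt_content[of la "partition_mset la"] by (auto simp: mcoeff_schur card_eq_0_iff)
qed

text \<open>Justifies the \<open>THE\<close> in \<open>lr_coeff\<close>. The weight is negated
  because a Schur function reaches only monomials of larger index sum, while elimination expects
  smaller weights.\<close>

lemma lr_coeff:
  assumes la: "is_partition la" and mu: "is_partition mu"
  shows "schur la * schur mu = (\<Sum>nu\<in>partitions_of (sum_list la + sum_list mu).
    mscale (lr_coeff la mu nu) (schur nu))"
proof -
  let ?P = "partitions_of (sum_list la + sum_list mu)"
  let ?w = "\<lambda>nu. - int (sum_mset (partition_mset nu))"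
  let ?Q = "\<lambda>c. (\<forall>nu. nu \<notin> ?P \<longrightarrow> c nu = 0) \<and>
    schur la * schur mu = (\<Sum>nu\<in>?P. mscale (c nu) (schur nu))"
  have tri: "ka = nu \<or> ?w ka < ?w nu"
    if "nu \<in> ?P" "ka \<in> ?P" "mcoeff (schur nu) (partition_mset ka) \<noteq> 0" for nu ka
  proof -
    have "ka = nu \<or> sum_mset (partition_mset nu) < sum_mset (partition_mset ka)"
      using schur_triangular[of nu ka] that by (simp add: partitions_of_def)
    then show ?thesis by (simp only: neg_less_iff_less of_nat_less_iff)
  qed
  have "\<exists>c. schur la * schur mu = (\<Sum>nu\<in>?P. mscale (c nu) (schur nu))"
  proof (rule triangular_family_spans[where w = ?w])
    show "schur nu \<in> Sym_deg (sum_list la + sum_list mu)" if "nu \<in> ?P" for nu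
      using schur_Sym_deg[of nu] that by (simp add: partitions_of_def)
    show "schur la * schur mu \<in> Sym_deg (sum_list la + sum_list mu)"
      using la mu by (intro Sym_deg_times schur_Sym_deg)
    show "mcoeff (schur nu) (partition_mset nu) \<noteq> 0" for nu by (rule schur_diagonal)
  qed (rule tri)
  then obtain c where c: "schur la * schur mu = (\<Sum>nu\<in>?P. mscale (c nu) (schur nu))" ..
  define c' where "c' nu = (if nu \<in> ?P then c nu else 0)" for nu
  have "?Q c'"
    unfolding c by (auto simp: c'_def intro!: sum.cong)
  moreover have "d = c'" if d: "?Q d" for d
  proof (rule ext)
    fix nu
    have eq: "(\<Sum>nu\<in>?P. mscale (d nu) (schur nu)) = (\<Sum>nu\<in>?P. mscale (c' nu) (schur nu))"
      using d \<open>?Q c'\<close> by metis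
    have "d nu = c' nu" if "nu \<in> ?P"
      by (rule triangular_family_unique[where w = ?w and b = schur, OF schur_diagonal tri eq that])
    then show "d nu = c' nu" using d \<open>?Q c'\<close> by (cases "nu \<in> ?P") auto
  qed
  ultimately have "\<exists>!c. ?Q c" by (intro ex1I[of _ c']) auto
  from theI'[OF this] show ?thesis unfolding lr_coeff_def by (rule conjunct2)
qed

lemma rho_sum:
  assumes "finite A" "\<And>x. x \<in> A \<Longrightarrow> f x \<in> Sym"
  shows "rho (\<Sum>x\<in>A. mscale (c x) (f x)) p = (\<Sum>x\<in>A. scale_xy (c x) (rho (f x) p))"
proof (rule ud_coeff_inject)
  fix k
  have "(\<Sum>x\<in>A. mscale (c x) (f x)) \<in> Sym" using assms(2) by (intro Sym_sum Sym_mscale)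
  then show "ud_coeff (rho (\<Sum>x\<in>A. mscale (c x) (f x)) p) k
      = ud_coeff (\<Sum>x\<in>A. scale_xy (c x) (rho (f x) p)) k"
    using assms(2) by (simp add: ud_coeff_rho principal_spec_sum ud_coeff_sum sum_distrib_right mult.assoc)
qed

theorem theorem13:
  shows "(\<forall>m N. \<forall>g\<in>Sym_deg m. \<forall>f\<in>QSym N.
            g * f \<in> QSym (N + m) \<and> Phi (N + m) (g * f) = rho g (Phi N f)) \<and>
         (\<forall>la N. is_partition la \<longrightarrow> (\<forall>f\<in>QSym N.
            Phi (N + sum_list la) (schur la * f) = G_part la (Phi N f))) \<and>
         (\<forall>la mu. is_partition la \<longrightarrow> is_partition mu \<longrightarrow>
            G_part la \<circ> G_part mu =
              (\<lambda>p. \<Sum>nu\<in>partitions_of (sum_list la + sum_list mu).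
                 scale_xy (lr_coeff la mu nu) (G_part nu p)))"
proof (intro conjI allI ballI impI)
  show "g * f \<in> QSym (N + m)" "Phi (N + m) (g * f) = rho g (Phi N f)"
    if "g \<in> Sym_deg m" "f \<in> QSym N" for m N g f
    using that by (simp_all add: Sym_deg_times_QSym Phi_times)
  show "Phi (N + sum_list la) (schur la * f) = G_part la (Phi N f)"
    if "is_partition la" "f \<in> QSym N" for la N f
    using that by (simp add: G_part_def Phi_times schur_Sym_deg)
  show "G_part la \<circ> G_part mu = (\<lambda>p. \<Sum>nu\<in>partitions_of (sum_list la + sum_list mu).
      scale_xy (lr_coeff la mu nu) (G_part nu p))"
    if la: "is_partition la" and mu: "is_partition mu" for la mu
  proof -
    have Sym: "schur nu \<in> Sym" if "is_partition nu" for nu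
      using schur_Sym_deg[OF that] by (rule Sym_deg_imp_Sym)
    have "G_part la \<circ> G_part mu = rho (schur la * schur mu)"
      using is_rho_rho Sym[OF la] Sym[OF mu] by (simp add: is_rho_def G_part_def)
    also have "\<dots> = (\<lambda>p. \<Sum>nu\<in>partitions_of (sum_list la + sum_list mu).
        scale_xy (lr_coeff la mu nu) (G_part nu p))"
      unfolding lr_coeff[OF la mu] G_part_def
      by (rule ext, rule rho_sum[OF finite_partitions_of]) (simp add: partitions_of_def Sym)
    finally show ?thesis .
  qed
qed

end
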